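(* Let $k$ be a field of characteristic $0$, let $n\ge3$, $S=k[x_1,\dots,x_n]$, and let $F=a_0p_1^3+a_1np_1p_2+a_2n^2p_3\in k[X_1,\dots,X_n]$ be any nonzero symmetric cubic form ($a_0,a_1,a_2\in k$). Then $S/\operatorname{ann}(F)$ satisfies the Strong Lefschetz Property.
   Context: $p_i=\sum_{j=1}^nX_j^i$. $S$ acts on $k[X_1,\dots,X_n]$ with $x_i$ acting as $\partial/\partial X_i$, and $\operatorname{ann}(F)\subseteq S$ is the annihilator of $F$. A graded artinian $k$-algebra $A$ (a quotient of $S$) satisfies the Strong Lefschetz Property if, for a general linear form $\ell$, the multiplication map $\times\ell^j:[A]_i\to[A]_{i+j}$ has maximal rank for all $i\ge0$ and $j\ge0$. *)

theory Defs
  imports "HOL-Library.Poly_Mapping" "HOL-Library.Cardinality"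
    "HOL-Algebra.QuotRing" "HOL-Algebra.Embedded_Algebras"
begin

section \<open>Polynomials in finitely many variables\<close>

text \<open>
  A polynomial maps exponent vectors to coefficients; its variables are indexed by a finite
  type \<open>'n\<close>, so the number of variables is \<open>CARD('n)\<close>.  Multiplication is the convolution product
  supplied by the library.  The same type serves as \<open>S = k[x\<^sub>1,\<dots>,x\<^sub>n]\<close> and as \<open>k[X\<^sub>1,\<dots>,X\<^sub>n]\<close>.
\<close>

type_synonym ('n, 'k) mpol = "('n \<Rightarrow>\<^sub>0 nat) \<Rightarrow>\<^sub>0 'k"

definition mconst :: "'k::zero \<Rightarrow> ('n, 'k) mpol" where
  "mconst c = Poly_Mapping.single 0 c"

definition mvar :: "'n \<Rightarrow> ('n, 'k::zero_neq_one) mpol" where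
  "mvar i = Poly_Mapping.single (Poly_Mapping.single i 1) 1"

definition meval :: "('n::finite \<Rightarrow> 'k) \<Rightarrow> ('n, 'k::comm_semiring_1) mpol \<Rightarrow> 'k" where
  "meval c G = (\<Sum>m \<in> Poly_Mapping.keys G. Poly_Mapping.lookup G m *
     (\<Prod>i\<in>UNIV. c i ^ Poly_Mapping.lookup m i))"

definition homogeneous_part :: "nat \<Rightarrow> ('n::finite, 'k::zero) mpol set" where
  "homogeneous_part d =
     {f. \<forall>m \<in> Poly_Mapping.keys f. (\<Sum>i\<in>UNIV. Poly_Mapping.lookup m i) = d}"

definition linear_form :: "('n::finite \<Rightarrow> 'k) \<Rightarrow> ('n, 'k::comm_semiring_1) mpol" where
  "linear_form c = (\<Sum>i\<in>UNIV. mconst (c i) * mvar i)"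

definition power_sum :: "nat \<Rightarrow> ('n::finite, 'k::comm_semiring_1) mpol" where
  "power_sum d = (\<Sum>j\<in>UNIV. mvar j ^ d)"


section \<open>The action by differentiation and annihilators\<close>

text \<open>
  If the exponent of \<open>X\<^sub>i\<close> in a monomial is \<open>0\<close>, the truncated subtraction below is harmless because
  the coefficient vanishes.
\<close>

definition mderiv :: "'n \<Rightarrow> ('n, 'k::comm_semiring_1) mpol \<Rightarrow> ('n, 'k) mpol" where
  "mderiv i F = (\<Sum>m \<in> Poly_Mapping.keys F.
     Poly_Mapping.single (m - Poly_Mapping.single i 1)
       (of_nat (Poly_Mapping.lookup m i) * Poly_Mapping.lookup F m))"

text \<open>
  The monomial with exponent vector \<open>m\<close> acts as the composition of the operators
  \<open>(\<partial>/\<partial>X\<^sub>i)\<^bsup>m i\<^esup>\<close>; the order of composition is immaterial since these commute.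
\<close>

definition monom_act :: "('n::finite \<Rightarrow>\<^sub>0 nat) \<Rightarrow> ('n, 'k::comm_semiring_1) mpol \<Rightarrow> ('n, 'k) mpol" where
  "monom_act m F = Finite_Set.fold (\<lambda>i. mderiv i ^^ Poly_Mapping.lookup m i) F UNIV"

definition diff_act :: "('n::finite, 'k::comm_semiring_1) mpol \<Rightarrow> ('n, 'k) mpol \<Rightarrow> ('n, 'k) mpol" where
  "diff_act g F = (\<Sum>m \<in> Poly_Mapping.keys g. mconst (Poly_Mapping.lookup g m) * monom_act m F)"

definition ann :: "('n::finite, 'k::comm_semiring_1) mpol \<Rightarrow> ('n, 'k) mpol set" where
  "ann F = {g. diff_act g F = 0}"


section \<open>Graded quotients and the Strong Lefschetz Property\<close>

definition mpol_ring :: "('n, 'k::comm_ring_1) mpol ring" where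
  "mpol_ring = \<lparr>carrier = UNIV, mult = (*), one = 1, zero = 0, add = (+)\<rparr>"

definition quot_part :: "('n::finite, 'k::comm_ring_1) mpol set \<Rightarrow> nat \<Rightarrow> ('n, 'k) mpol set set" where
  "quot_part I d = (\<lambda>f. I +>\<^bsub>mpol_ring\<^esub> f) ` homogeneous_part d"

text \<open>The copy of the ground field \<open>k\<close> in \<open>S/I\<close>, over which dimensions are taken.\<close>

definition quot_scalars :: "('n::finite, 'k::comm_ring_1) mpol set \<Rightarrow> ('n, 'k) mpol set set" where
  "quot_scalars I = range (\<lambda>c. I +>\<^bsub>mpol_ring\<^esub> mconst c)"

definition quot_dim :: "('n::finite, 'k::comm_ring_1) mpol set \<Rightarrow> ('n, 'k) mpol set set \<Rightarrow> nat" where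
  "quot_dim I E = ring.dim (mpol_ring Quot I) (quot_scalars I) E"

definition mult_power_map ::
  "('n::finite, 'k::comm_ring_1) mpol set \<Rightarrow> ('n, 'k) mpol \<Rightarrow> nat \<Rightarrow> ('n, 'k) mpol set \<Rightarrow> ('n, 'k) mpol set" where
  "mult_power_map I l j a =
     ((I +>\<^bsub>mpol_ring\<^esub> l) [^]\<^bsub>mpol_ring Quot I\<^esub> j) \<otimes>\<^bsub>mpol_ring Quot I\<^esub> a"

definition mult_power_max_rank ::
  "('n::finite, 'k::comm_ring_1) mpol set \<Rightarrow> ('n, 'k) mpol \<Rightarrow> nat \<Rightarrow> nat \<Rightarrow> bool" where
  "mult_power_max_rank I l j i \<longleftrightarrow>
     quot_dim I (mult_power_map I l j ` quot_part I i) =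
       min (quot_dim I (quot_part I i)) (quot_dim I (quot_part I (i + j)))"

definition zariski_open :: "('n::finite \<Rightarrow> 'k::comm_semiring_1) set \<Rightarrow> bool" where
  "zariski_open U \<longleftrightarrow> (\<exists>P. U = {c. \<exists>G\<in>P. meval c G \<noteq> 0})"

text \<open>
  The Strong Lefschetz Property of \<open>S/I\<close>, for a homogeneous ideal \<open>I\<close> with artinian quotient.
  A general linear form is one whose coefficient vector lies in some nonempty Zariski-open subset
  of \<open>k\<^sup>n\<close>; one such set has to work for all \<open>i\<close> and \<open>j\<close>.
\<close>

definition strong_lefschetz :: "('n::finite, 'k::field) mpol set \<Rightarrow> bool" where
  "strong_lefschetz I \<longleftrightarrow>
     (\<exists>U. zariski_open U \<and> U \<noteq> {} \<and>
       (\<forall>c\<in>U. \<forall>i j. mult_power_max_rank I (linear_form c) j i))"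

end

theory Submission
  imports Defs "HOL-Analysis.Determinants"
begin

text \<open>
  Let \<open>F\<close> be a cubic form with \<open>F(c) \<noteq> 0\<close>.  Since \<open>\<ell>\<^sub>c\<^sup>3\<close> acts on \<open>F\<close> as the scalar \<open>3! F(c)\<close>, the
  multiplications by powers of \<open>\<ell>\<^sub>c\<close> out of degree 0 and into degree 3 have maximal rank.  The only
  other one, from degree 1 to degree 2, is given by the Hessian matrix of \<open>F\<close> at \<open>c\<close>.  It is injective
  if the kernel of this matrix is as small as possible, that is, if its elements are killed by the
  Hessian matrices at all points; and a matrix of polynomials has its smallest kernel on a
  Zariski-open set.  So it suffices to exhibit one point \<open>c\<close> with both properties.  When points are
  split into mean \<open>m\<close> and deviation \<open>y\<close>, a symmetric cubic becomes a combination of \<open>m\<^sup>3\<close>, \<open>m \<Sum> y\<^sub>i\<^sup>2\<close>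
  and \<open>\<Sum> y\<^sub>i\<^sup>3\<close>, for which the kernel is computed directly at suitable points.
\<close>

declare One_nat_def [simp del]

section \<open>Polynomials and their evaluation\<close>

lemma update_eq_single_add:
  assumes "a \<notin> Poly_Mapping.keys f"
  shows "Poly_Mapping.update a b f = Poly_Mapping.single a b + f"
  using assms
  by (intro poly_mapping_eqI) (auto simp: lookup_update lookup_add lookup_single in_keys_iff when_def)

lemma poly_mapping_add_induct [case_names single add]:
  fixes f :: "'a \<Rightarrow>\<^sub>0 'b::comm_monoid_add"
  assumes single: "\<And>a b. P (Poly_Mapping.single a b)"
    and add: "\<And>f g. P f \<Longrightarrow> P g \<Longrightarrow> P (f + g)"
  shows "P f"
proof (induction f rule: update_induct)
  case const
  show ?case using single[of undefined 0] by simp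
qed (simp add: update_eq_single_add single add)

lemma mconst_0 [simp]: "mconst 0 = 0"
  by (simp add: mconst_def)

lemma mconst_1 [simp]: "mconst 1 = 1"
  by (simp add: mconst_def)

lemma mconst_add: "mconst (a + b) = mconst a + mconst b"
  by (simp add: mconst_def single_add)

lemma mconst_mult: "mconst (a * b) = mconst a * mconst b"
  by (simp add: mconst_def mult_single)

lemma mconst_of_nat: "mconst (of_nat k) = of_nat k"
  by (simp add: mconst_def)

lemma mconst_of_int: "mconst (of_int k) = of_int k"
  by (simp add: mconst_def)

lemma mconst_numeral: "mconst (numeral k) = numeral k"
  by (simp add: mconst_def)

lemma mconst_mult_single: "mconst a * Poly_Mapping.single m b = Poly_Mapping.single m (a * b)"
  by (simp add: mconst_def mult_single)

lemma lookup_mconst_mult: "Poly_Mapping.lookup (mconst a * f) m = a * Poly_Mapping.lookup f m"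
  by (induction f rule: poly_mapping_add_induct)
    (auto simp: mconst_mult_single distrib_left lookup_add lookup_single when_def)

lemma meval_single:
  "meval c (Poly_Mapping.single m a) = a * (\<Prod>i\<in>UNIV. c i ^ Poly_Mapping.lookup m i)"
  by (simp add: meval_def)

lemma meval_0 [simp]: "meval c 0 = 0"
  by (simp add: meval_def)

lemma meval_add: "meval c (f + g) = meval c f + meval c g"
  unfolding meval_def by (rule setsum_keys_plus_distrib) (simp_all add: distrib_right)

lemma meval_minus:
  fixes c :: "'n::finite \<Rightarrow> 'k::comm_ring_1"
  shows "meval c (f - g) = meval c f - meval c g"
  using meval_add[of c "f - g" g] by simp

lemma meval_mult: "meval c (f * g) = meval c f * meval c g"
proof (induction f rule: poly_mapping_add_induct)
  case (single m a)
  show ?case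
    by (induction g rule: poly_mapping_add_induct)
      (simp_all add: meval_single meval_add mult_single algebra_simps lookup_add power_add prod.distrib)
qed (simp add: meval_add distrib_right)

lemma meval_mconst [simp]: "meval c (mconst a) = a"
  by (simp add: mconst_def meval_single)

lemma meval_1 [simp]: "meval c 1 = 1"
  using meval_mconst[of c 1] by simp

lemma meval_of_nat [simp]: "meval c (of_nat k) = of_nat k"
  using meval_mconst[of c "of_nat k"] by (simp add: mconst_of_nat)

lemma meval_of_int [simp]:
  fixes c :: "'n::finite \<Rightarrow> 'k::comm_ring_1"
  shows "meval c (of_int k) = of_int k"
  using meval_mconst[of c "of_int k"] by (simp add: mconst_of_int)

lemma meval_numeral [simp]: "meval c (numeral k) = numeral k"
  using meval_mconst[of c "numeral k"] by (simp add: mconst_numeral)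

lemma meval_mvar [simp]: "meval c (mvar i) = c i"
proof -
  have "(\<Prod>j\<in>UNIV. c j ^ Poly_Mapping.lookup (Poly_Mapping.single i 1) j) =
      (\<Prod>j\<in>UNIV. if i = j then c j else 1)"
    by (intro prod.cong) (auto simp: lookup_single)
  then show ?thesis by (simp add: mvar_def meval_single)
qed

lemma meval_power: "meval c (f ^ k) = meval c f ^ k"
  by (induction k) (simp_all add: meval_mult)

lemma meval_sum: "meval c (sum f A) = (\<Sum>i\<in>A. meval c (f i))"
  by (induction A rule: infinite_finite_induct) (simp_all add: meval_add)

lemma meval_prod: "meval c (prod f A) = (\<Prod>i\<in>A. meval c (f i))"
  by (induction A rule: infinite_finite_induct) (simp_all add: meval_mult)

lemma meval_power_sum: "meval c (power_sum d) = (\<Sum>j\<in>UNIV. c j ^ d)"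
  by (simp add: power_sum_def meval_sum meval_power)

lemma meval_det:
  fixes A :: "('n::finite, 'k::comm_ring_1) mpol ^ 'm ^ 'm"
  shows "meval c (det A) = det (map_matrix (meval c) A)"
  by (simp add: det_def meval_sum meval_mult meval_prod)

section \<open>Homogeneous polynomials\<close>

definition mdegree :: "('n::finite \<Rightarrow>\<^sub>0 nat) \<Rightarrow> nat" where
  "mdegree m = (\<Sum>i\<in>UNIV. Poly_Mapping.lookup m i)"

lemma mdegree_eq_0_iff [simp]: "mdegree m = 0 \<longleftrightarrow> m = 0"
  by (auto simp: mdegree_def intro!: poly_mapping_eqI)

lemma mdegree_add: "mdegree (m + m') = mdegree m + mdegree m'"
  by (simp add: mdegree_def lookup_add sum.distrib)

lemma mdegree_single [simp]: "mdegree (Poly_Mapping.single i k) = k"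
  by (simp add: mdegree_def lookup_single when_def)

lemma single_plus_minus_single:
  assumes "Poly_Mapping.lookup m i \<noteq> 0"
  shows "Poly_Mapping.single i 1 + (m - Poly_Mapping.single i 1) = (m :: 'n \<Rightarrow>\<^sub>0 nat)"
  using assms by (intro poly_mapping_eqI) (auto simp: lookup_add lookup_minus lookup_single when_def)

lemma mdegree_SucE:
  assumes "mdegree m = Suc d"
  obtains i m' where "m = Poly_Mapping.single i 1 + m'" "mdegree m' = d"
proof -
  obtain i where "Poly_Mapping.lookup m i \<noteq> 0"
    using assms by (metis mdegree_eq_0_iff nat.distinct(1) poly_mapping_eqI lookup_zero)
  then have m: "m = Poly_Mapping.single i 1 + (m - Poly_Mapping.single i 1)"
    using single_plus_minus_single by metis
  then have "mdegree (m - Poly_Mapping.single i 1) = d"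
    using assms mdegree_add[of "Poly_Mapping.single i 1" "m - Poly_Mapping.single i 1"] by simp
  with m show ?thesis by (rule that)
qed

lemma monomial_induct [case_names zero single_add]:
  fixes m :: "'n::finite \<Rightarrow>\<^sub>0 nat"
  assumes zero: "P 0" and step: "\<And>i m. P m \<Longrightarrow> P (Poly_Mapping.single i 1 + m)"
  shows "P m"
proof (induction "mdegree m" arbitrary: m)
  case 0
  then show ?case using zero by simp
next
  case (Suc d)
  obtain i m' where "m = Poly_Mapping.single i 1 + m'" "mdegree m' = d"
    using Suc.hyps(2) mdegree_SucE by metis
  with Suc.hyps(1) show ?case by (simp add: step)
qed

lemma finite_mdegree: "finite {m :: 'n::finite \<Rightarrow>\<^sub>0 nat. mdegree m = d}"
proof (induction d)
  case (Suc d)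
  have "{m :: 'n \<Rightarrow>\<^sub>0 nat. mdegree m = Suc d} \<subseteq>
     (\<lambda>(i, m). Poly_Mapping.single i 1 + m) ` (UNIV \<times> {m. mdegree m = d})"
    by (force elim!: mdegree_SucE)
  moreover have "finite \<dots>"
    using Suc by simp
  ultimately show ?case by (rule finite_subset)
qed simp

lemma homogeneous_part_iff:
  "f \<in> homogeneous_part d \<longleftrightarrow> (\<forall>m. Poly_Mapping.lookup f m \<noteq> 0 \<longrightarrow> mdegree m = d)"
  by (auto simp: homogeneous_part_def mdegree_def in_keys_iff)

lemma single_in_homogeneous_part:
  "mdegree m = d \<Longrightarrow> Poly_Mapping.single m c \<in> homogeneous_part d"
  by (auto simp: homogeneous_part_iff lookup_single when_def)

lemma zero_in_homogeneous_part: "0 \<in> homogeneous_part d"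
  by (simp add: homogeneous_part_iff)

lemma homogeneous_part_add:
  fixes f g :: "('n::finite, 'k::comm_monoid_add) mpol"
  assumes "f \<in> homogeneous_part d" "g \<in> homogeneous_part d"
  shows "f + g \<in> homogeneous_part d"
  using assms by (auto simp: homogeneous_part_iff lookup_add) (metis add_0)

lemma homogeneous_part_sum:
  fixes f :: "'a \<Rightarrow> ('n::finite, 'k::comm_monoid_add) mpol"
  shows "(\<And>i. i \<in> A \<Longrightarrow> f i \<in> homogeneous_part d) \<Longrightarrow> sum f A \<in> homogeneous_part d"
  by (induction A rule: infinite_finite_induct)
    (auto simp: zero_in_homogeneous_part homogeneous_part_add)

lemma homogeneous_part_minus:
  fixes f g :: "('n::finite, 'k::ab_group_add) mpol"
  assumes "f \<in> homogeneous_part d" "g \<in> homogeneous_part d"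
  shows "f - g \<in> homogeneous_part d"
  using assms by (auto simp: homogeneous_part_iff lookup_minus) (metis diff_zero)

lemma homogeneous_part_mult:
  fixes f g :: "('n::finite, 'k::comm_semiring_1) mpol"
  assumes "f \<in> homogeneous_part d" "g \<in> homogeneous_part e"
  shows "f * g \<in> homogeneous_part (d + e)"
  unfolding homogeneous_part_iff
proof (intro allI impI)
  fix m assume "Poly_Mapping.lookup (f * g) m \<noteq> 0"
  then obtain a b where "m = a + b" "a \<in> Poly_Mapping.keys f" "b \<in> Poly_Mapping.keys g"
    using keys_mult[of f g] by (auto simp: in_keys_iff)
  then show "mdegree m = d + e"
    using assms by (auto simp: homogeneous_part_iff mdegree_add in_keys_iff)
qed

lemma mconst_in_homogeneous_part: "mconst c \<in> homogeneous_part 0"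
  by (simp add: mconst_def single_in_homogeneous_part)

lemma mvar_in_homogeneous_part: "mvar i \<in> homogeneous_part 1"
  by (simp add: mvar_def single_in_homogeneous_part)

lemma homogeneous_part_mconst_mult:
  fixes f :: "('n::finite, 'k::comm_semiring_1) mpol"
  shows "f \<in> homogeneous_part d \<Longrightarrow> mconst c * f \<in> homogeneous_part d"
  using homogeneous_part_mult[OF mconst_in_homogeneous_part] by fastforce

lemma homogeneous_part_power:
  fixes f :: "('n::finite, 'k::comm_semiring_1) mpol"
  assumes "f \<in> homogeneous_part d"
  shows "f ^ k \<in> homogeneous_part (k * d)"
proof (induction k)
  case 0
  show ?case using mconst_in_homogeneous_part[of "1::'k"] by simp
qed (use homogeneous_part_mult[OF assms] in auto)

lemma linear_form_in_homogeneous_part: "linear_form c \<in> homogeneous_part 1"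
  unfolding linear_form_def
  by (intro homogeneous_part_sum homogeneous_part_mconst_mult mvar_in_homogeneous_part)

lemma power_sum_in_homogeneous_part: "power_sum d \<in> homogeneous_part d"
  unfolding power_sum_def
  using homogeneous_part_power[OF mvar_in_homogeneous_part, of _ d]
  by (intro homogeneous_part_sum) simp

lemma homogeneous_part_0E:
  fixes f :: "('n::finite, 'k::zero) mpol"
  assumes "f \<in> homogeneous_part 0"
  obtains a where "f = mconst a"
proof
  show "f = mconst (Poly_Mapping.lookup f 0)"
    using assms by (intro poly_mapping_eqI)
      (auto simp: mconst_def lookup_single when_def homogeneous_part_iff)
qed

section \<open>Partial derivatives\<close>

lemma mderiv_single:
  "mderiv i (Poly_Mapping.single m c) =
     Poly_Mapping.single (m - Poly_Mapping.single i 1) (of_nat (Poly_Mapping.lookup m i) * c)"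
  by (cases "c = 0") (simp_all add: mderiv_def)

lemma mderiv_0 [simp]: "mderiv i 0 = 0"
  by (simp add: mderiv_def)

lemma mderiv_add: "mderiv i (f + g) = mderiv i f + mderiv i g"
  unfolding mderiv_def by (rule setsum_keys_plus_distrib) (simp_all add: distrib_left single_add)

lemma mderiv_sum: "mderiv i (sum f A) = (\<Sum>j\<in>A. mderiv i (f j))"
  by (induction A rule: infinite_finite_induct) (simp_all add: mderiv_add)

lemma mderiv_mconst [simp]: "mderiv i (mconst c) = 0"
  by (simp add: mconst_def mderiv_single)

lemma mderiv_of_nat [simp]: "mderiv i (of_nat k) = 0"
  by (metis mderiv_mconst mconst_of_nat)

lemma mderiv_numeral [simp]: "mderiv i (numeral k) = 0"
  by (metis mderiv_mconst mconst_numeral)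

lemma mderiv_mvar: "mderiv i (mvar j) = of_bool (i = j)"
  by (simp add: mvar_def mderiv_single lookup_single when_def)

lemma mderiv_mult: "mderiv i (f * g) = mderiv i f * g + f * mderiv i g"
proof (induction f rule: poly_mapping_add_induct)
  case (single m a)
  show ?case
  proof (induction g rule: poly_mapping_add_induct)
    case (single k b)
    let ?e = "Poly_Mapping.single i (1::nat)"
    have shift: "Poly_Mapping.single (p + q - ?e) (of_nat (Poly_Mapping.lookup p i) * x) =
       Poly_Mapping.single (p - ?e + q) (of_nat (Poly_Mapping.lookup p i) * x)" for p q x
    proof (cases "Poly_Mapping.lookup p i = 0")
      case False
      then have "p + q - ?e = p - ?e + q"
        by (intro poly_mapping_eqI) (auto simp: lookup_add lookup_minus lookup_single when_def)
      then show ?thesis by simp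
    qed simp
    show ?case
      using shift[of m k "a * b"] shift[of k m "a * b"]
      by (simp add: mderiv_single mult_single lookup_add single_add algebra_simps)
  qed (simp add: mderiv_add distrib_left add_ac)
qed (simp add: mderiv_add distrib_right add_ac)

lemma mderiv_mconst_mult: "mderiv i (mconst a * f) = mconst a * mderiv i f"
  by (simp add: mderiv_mult)

lemma mderiv_power: "mderiv i (f ^ k) = of_nat k * f ^ (k - 1) * mderiv i f"
proof (induction k)
  case (Suc k)
  then show ?case by (cases k) (simp_all add: mderiv_mult algebra_simps)
qed (use mderiv_of_nat[of i 1] in simp)

lemma mderiv_power_sum: "mderiv i (power_sum d) = of_nat d * mvar i ^ (d - 1)"
  by (simp add: power_sum_def mderiv_sum mderiv_power mderiv_mvar of_bool_def if_distrib cong: if_cong)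

lemma lookup_mderiv:
  "Poly_Mapping.lookup (mderiv i f) m =
     of_nat (Suc (Poly_Mapping.lookup m i)) * Poly_Mapping.lookup f (Poly_Mapping.single i 1 + m)"
proof (induction f rule: poly_mapping_add_induct)
  case (single k c)
  let ?e = "Poly_Mapping.single i (1::nat)"
  show ?case
  proof (cases "Poly_Mapping.lookup k i = 0")
    case True
    then have "k \<noteq> ?e + m" by (auto simp: lookup_add)
    with True show ?thesis by (simp add: mderiv_single lookup_single_not_eq)
  next
    case False
    then have "k - ?e = m \<longleftrightarrow> k = ?e + m"
      by (metis single_plus_minus_single add_diff_cancel_left')
    then show ?thesis by (auto simp: mderiv_single lookup_single lookup_add when_def)
  qed
qed (simp add: mderiv_add lookup_add distrib_left)

lemma mderiv_commute: "mderiv i (mderiv j f) = mderiv j (mderiv i f)"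
  by (rule poly_mapping_eqI) (auto simp: lookup_mderiv lookup_add lookup_single when_def add_ac mult_ac)

lemma homogeneous_part_mderiv:
  "f \<in> homogeneous_part (Suc d) \<Longrightarrow> mderiv i f \<in> homogeneous_part d"
  by (auto simp: homogeneous_part_iff lookup_mderiv mdegree_add dest!: mult_not_zero)

lemma homogeneous_eq_0_if_mderiv_eq_0:
  fixes f :: "('n::finite, 'k::field_char_0) mpol"
  assumes "f \<in> homogeneous_part (Suc d)" "\<And>i. mderiv i f = 0"
  shows "f = 0"
proof (rule poly_mapping_eqI, rule ccontr)
  fix m assume lookup_m: "Poly_Mapping.lookup f m \<noteq> Poly_Mapping.lookup 0 m"
  then have "mdegree m = Suc d"
    using assms(1) by (simp add: homogeneous_part_iff)
  then obtain i m' where m: "m = Poly_Mapping.single i 1 + m'" by (rule mdegree_SucE)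
  have "Poly_Mapping.lookup (mderiv i f) m' = 0" by (simp add: assms(2))
  then show False using lookup_m by (simp add: m lookup_mderiv del: of_nat_Suc)
qed

lemma lookup_mvar_mult_mderiv:
  "Poly_Mapping.lookup (mvar i * mderiv i f) m =
     of_nat (Poly_Mapping.lookup m i) * Poly_Mapping.lookup f m"
proof (induction f rule: poly_mapping_add_induct)
  case (single k c)
  show ?case
  proof (cases "Poly_Mapping.lookup k i = 0")
    case False
    then have "mvar i * mderiv i (Poly_Mapping.single k c) =
        Poly_Mapping.single k (of_nat (Poly_Mapping.lookup k i) * c)"
      by (simp add: mvar_def mderiv_single mult_single single_plus_minus_single)
    then show ?thesis by (simp add: lookup_single when_def)
  qed (auto simp: mderiv_single lookup_single when_def)
qed (simp add: mderiv_add lookup_add distrib_left)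

lemma euler_homogeneous:
  assumes "f \<in> homogeneous_part d"
  shows "(\<Sum>i\<in>UNIV. mvar i * mderiv i f) = of_nat d * f"
proof (rule poly_mapping_eqI)
  fix m
  have "Poly_Mapping.lookup (\<Sum>i\<in>UNIV. mvar i * mderiv i f) m =
      of_nat (mdegree m) * Poly_Mapping.lookup f m"
    by (simp add: lookup_sum lookup_mvar_mult_mderiv mdegree_def sum_distrib_right)
  also have "\<dots> = Poly_Mapping.lookup (of_nat d * f) m"
    using assms by (cases "Poly_Mapping.lookup f m = 0")
      (auto simp: homogeneous_part_iff lookup_mconst_mult simp flip: mconst_of_nat)
  finally show "Poly_Mapping.lookup (\<Sum>i\<in>UNIV. mvar i * mderiv i f) m =
      Poly_Mapping.lookup (of_nat d * f) m" .
qed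

lemma homogeneous_part_1E:
  fixes f :: "('n::finite, 'k::comm_semiring_1) mpol"
  assumes "f \<in> homogeneous_part 1"
  obtains v where "f = linear_form v"
proof -
  have "f \<in> homogeneous_part (Suc 0)" using assms by (simp add: One_nat_def)
  then have "\<exists>a. mderiv i f = mconst a" for i
    by (metis homogeneous_part_mderiv homogeneous_part_0E)
  then obtain v where "\<And>i. mderiv i f = mconst (v i)" by metis
  then have "f = linear_form v"
    using euler_homogeneous[OF assms] by (simp add: linear_form_def mult.commute)
  then show ?thesis by (rule that)
qed

section \<open>The action of polynomials by differentiation\<close>

interpretation mderiv: comp_fun_commute "mderiv :: 'n \<Rightarrow> ('n, 'k::comm_semiring_1) mpol \<Rightarrow> ('n, 'k) mpol"
  by unfold_locales (simp add: fun_eq_iff mderiv_commute)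

lemma monom_act_0 [simp]:
  fixes f :: "('n::finite, 'k::comm_semiring_1) mpol"
  shows "monom_act 0 f = f"
proof -
  interpret comp_fun_commute "\<lambda>(i::'n) g::('n, 'k) mpol. g"
    by unfold_locales simp
  have "Finite_Set.fold (\<lambda>i g. g) f A = f" if "finite A" for A :: "'n set"
    using that by induction (simp_all add: fold_insert)
  then show ?thesis by (simp add: monom_act_def id_def)
qed

lemma monom_act_single_add:
  fixes f :: "('n::finite, 'k::comm_semiring_1) mpol"
  shows "monom_act (Poly_Mapping.single i 1 + m) f = mderiv i (monom_act m f)"
proof -
  let ?act = "\<lambda>k i. (mderiv i :: ('n, 'k) mpol \<Rightarrow> _) ^^ Poly_Mapping.lookup k i"
  let ?m = "Poly_Mapping.single i 1 + m"
  interpret act: comp_fun_commute "?act k" for k by (rule mderiv.comp_fun_commute_funpow)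
  have "monom_act ?m f = ?act ?m i (Finite_Set.fold (?act ?m) f (UNIV - {i}))"
    unfolding monom_act_def by (rule act.fold_rec) auto
  also have "Finite_Set.fold (?act ?m) f (UNIV - {i}) = Finite_Set.fold (?act m) f (UNIV - {i})"
    using act.comp_fun_commute_on_axioms[of ?m] act.comp_fun_commute_on_axioms[of m]
    by (rule Finite_Set.fold_cong) (simp_all add: lookup_add lookup_single_not_eq)
  also have "?act ?m i \<dots> = mderiv i (?act m i \<dots>)"
    by (simp add: lookup_add One_nat_def)
  also have "?act m i (Finite_Set.fold (?act m) f (UNIV - {i})) = monom_act m f"
    unfolding monom_act_def by (rule act.fold_rec[symmetric]) auto
  finally show ?thesis .
qed

lemma monom_act_add_monomial: "monom_act (m + m') f = monom_act m (monom_act m' f)"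
  by (induction m rule: monomial_induct) (simp_all add: monom_act_single_add add.assoc)

lemma monom_act_add: "monom_act m (f + g) = monom_act m f + monom_act m g"
  by (induction m rule: monomial_induct) (simp_all add: monom_act_single_add mderiv_add)

lemma monom_act_mconst_mult: "monom_act m (mconst a * f) = mconst a * monom_act m f"
  by (induction m rule: monomial_induct) (simp_all add: monom_act_single_add mderiv_mconst_mult)

lemma lookup_monom_act_nonzeroD:
  "Poly_Mapping.lookup (monom_act m f) k \<noteq> 0 \<Longrightarrow> Poly_Mapping.lookup f (k + m) \<noteq> 0"
proof (induction m arbitrary: k rule: monomial_induct)
  case (single_add i m)
  then have "Poly_Mapping.lookup (monom_act m f) (Poly_Mapping.single i 1 + k) \<noteq> 0"
    by (auto simp: monom_act_single_add lookup_mderiv)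
  from single_add.IH[OF this] show ?case by (simp add: add_ac)
qed simp

lemma diff_act_single [simp]: "diff_act (Poly_Mapping.single m a) f = mconst a * monom_act m f"
  by (simp add: diff_act_def)

lemma diff_act_0_left [simp]: "diff_act 0 f = 0"
  by (simp add: diff_act_def)

lemma diff_act_add_left: "diff_act (g + h) f = diff_act g f + diff_act h f"
  unfolding diff_act_def
  by (rule setsum_keys_plus_distrib) (simp_all add: mconst_add distrib_right)

lemma diff_act_sum_left: "diff_act (sum g A) f = (\<Sum>i\<in>A. diff_act (g i) f)"
  by (induction A rule: infinite_finite_induct) (simp_all add: diff_act_add_left)

lemma diff_act_minus_left:
  fixes f :: "('n::finite, 'k::comm_ring_1) mpol"
  shows "diff_act (g - h) f = diff_act g f - diff_act h f"
  using diff_act_add_left[of "g - h" h f] by simp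

lemma diff_act_add_right: "diff_act g (f + f') = diff_act g f + diff_act g f'"
  by (induction g rule: poly_mapping_add_induct)
    (simp_all add: diff_act_add_left monom_act_add distrib_left add_ac)

lemma diff_act_0_right [simp]:
  fixes g :: "('n::finite, 'k::comm_ring_1) mpol"
  shows "diff_act g 0 = 0"
  using diff_act_add_right[of g 0 0] by simp

lemma diff_act_mult: "diff_act (g * h) f = diff_act g (diff_act h f)"
proof (induction g rule: poly_mapping_add_induct)
  case (single m a)
  show ?case
    by (induction h rule: poly_mapping_add_induct)
      (simp_all add: mult_single diff_act_add_left monom_act_add_monomial monom_act_add
        monom_act_mconst_mult mconst_mult distrib_left mult.assoc)
qed (simp add: diff_act_add_left distrib_right)

lemma diff_act_mconst [simp]: "diff_act (mconst a) f = mconst a * f"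
  by (subst mconst_def) simp

lemma diff_act_1 [simp]: "diff_act 1 f = f"
  using diff_act_mconst[of 1 f] by simp

lemma diff_act_mvar: "diff_act (mvar i) f = mderiv i f"
  using monom_act_single_add[of i 0 f] by (simp add: mvar_def)

lemma diff_act_linear_form: "diff_act (linear_form c) f = (\<Sum>i\<in>UNIV. mconst (c i) * mderiv i f)"
  by (simp add: linear_form_def diff_act_sum_left diff_act_mult diff_act_mvar)

lemma mderiv_diff_act: "mderiv i (diff_act g f) = diff_act g (mderiv i f)"
  using diff_act_mult[of "mvar i" g f] diff_act_mult[of g "mvar i" f]
  by (simp add: diff_act_mvar mult.commute)

lemma homogeneous_part_diff_act:
  assumes "f \<in> homogeneous_part (d + e)" "g \<in> homogeneous_part e"
  shows "diff_act g f \<in> homogeneous_part d"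
  unfolding diff_act_def
proof (intro homogeneous_part_sum homogeneous_part_mconst_mult)
  fix m assume "m \<in> Poly_Mapping.keys g"
  then have "mdegree m = e"
    using assms(2) by (simp add: homogeneous_part_iff in_keys_iff)
  with assms(1) show "monom_act m f \<in> homogeneous_part d"
    by (auto simp: homogeneous_part_iff mdegree_add dest: lookup_monom_act_nonzeroD)
qed

lemma diff_act_eq_0_if_degree_less:
  assumes "f \<in> homogeneous_part d" "g \<in> homogeneous_part e" "d < e"
  shows "diff_act g f = 0"
  unfolding diff_act_def
proof (rule sum.neutral, rule ballI)
  fix m assume "m \<in> Poly_Mapping.keys g"
  then have "mdegree m = e"
    using assms(2) by (simp add: homogeneous_part_iff in_keys_iff)
  then have "Poly_Mapping.lookup (monom_act m f) k = 0" for k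
    using assms(1,3) by (auto simp: homogeneous_part_iff mdegree_add dest: lookup_monom_act_nonzeroD)
  then have "monom_act m f = 0" by (intro poly_mapping_eqI) simp
  then show "mconst (Poly_Mapping.lookup g m) * monom_act m f = 0" by simp
qed

lemma meval_diff_act_linear_form:
  assumes "f \<in> homogeneous_part d"
  shows "meval c (diff_act (linear_form c) f) = of_nat d * meval c f"
proof -
  have "meval c (diff_act (linear_form c) f) = meval c (\<Sum>i\<in>UNIV. mvar i * mderiv i f)"
    by (simp add: diff_act_linear_form meval_sum meval_mult)
  then show ?thesis using assms by (simp add: euler_homogeneous meval_mult)
qed

lemma diff_act_linear_form_power:
  assumes "f \<in> homogeneous_part d"
  shows "diff_act (linear_form c ^ d) f = mconst (fact d * meval c f)"
  using assms
proof (induction d arbitrary: f)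
  case 0
  then obtain a where "f = mconst a" by (rule homogeneous_part_0E)
  then show ?case by simp
next
  case (Suc d)
  have "diff_act (linear_form c ^ Suc d) f = diff_act (linear_form c ^ d) (diff_act (linear_form c) f)"
    by (simp add: power_Suc2 diff_act_mult del: power_Suc)
  also have "\<dots> = mconst (fact d * meval c (diff_act (linear_form c) f))"
    using homogeneous_part_diff_act[of f d 1] Suc.prems linear_form_in_homogeneous_part[of c]
    by (intro Suc.IH) (simp add: One_nat_def)
  also have "fact d * meval c (diff_act (linear_form c) f) = fact (Suc d) * meval c f"
    using Suc.prems by (simp add: meval_diff_act_linear_form algebra_simps)
  finally show ?case .
qed

section \<open>Linear maps of embedded algebras\<close>

context ring
begin

lemma dimension_mono:
  assumes K: "subfield K R" and "dimension m K V" "dimension n K E" "V \<subseteq> E"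
  shows "m \<le> n"
proof -
  obtain Us where Us: "set Us \<subseteq> carrier R" "independent K Us" "length Us = m" "Span K Us = V"
    using exists_base[OF K assms(2)] by auto
  then have "set Us \<subseteq> E" using Span_base_incl[OF K Us(1)] assms(4) by blast
  then show ?thesis using independent_length_le_dimension[OF K assms(3) Us(2)] Us(3) by simp
qed

definition linear_map :: "'a set \<Rightarrow> ('a \<Rightarrow> 'a) \<Rightarrow> bool" where
  "linear_map K f \<longleftrightarrow> f \<in> carrier R \<rightarrow> carrier R \<and>
     (\<forall>k\<in>K. \<forall>u\<in>carrier R. \<forall>v\<in>carrier R. f (k \<otimes> u \<oplus> v) = k \<otimes> f u \<oplus> f v)"

context
  fixes K :: "'a set" and f :: "'a \<Rightarrow> 'a"
  assumes K: "subfield K R" and f: "linear_map K f"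
begin

lemma linear_map_closed: "v \<in> carrier R \<Longrightarrow> f v \<in> carrier R"
  using f by (auto simp: linear_map_def)

lemma linear_map_zero: "f \<zero> = \<zero>"
proof -
  have "f (\<one> \<otimes> \<zero> \<oplus> \<zero>) = \<one> \<otimes> f \<zero> \<oplus> f \<zero>"
    using f subringE(3)[OF subfieldE(1)[OF K]] unfolding linear_map_def by blast
  then show ?thesis using linear_map_closed[OF zero_closed] by simp
qed

lemma linear_map_line_extension:
  assumes "u \<in> carrier R" "E \<subseteq> carrier R"
  shows "f ` line_extension K u E = line_extension K (f u) (f ` E)"
proof -
  have "f (k \<otimes> u \<oplus> e) = k \<otimes> f u \<oplus> f e" if "k \<in> K" "e \<in> E" for k e
    using f that assms by (auto simp: linear_map_def)
  then show ?thesis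
    unfolding set_eq_iff line_extension_mem_iff image_iff Bex_def by metis
qed

lemma linear_map_Span: "set Us \<subseteq> carrier R \<Longrightarrow> f ` Span K Us = Span K (map f Us)"
  by (induction Us)
    (use linear_map_line_extension Span_in_carrier[OF subfieldE(3)[OF K]]
      in \<open>auto simp: linear_map_zero\<close>)

lemma independent_if_independent_map:
  "set Us \<subseteq> carrier R \<Longrightarrow> independent K (map f Us) \<Longrightarrow> independent K Us"
proof (induction Us)
  case (Cons u Us)
  have "f u \<notin> f ` Span K Us" "independent K (map f Us)"
    using Cons.prems linear_map_Span[of Us] independent_backwards[of K "f u" "map f Us"] by auto
  then show ?case using Cons by (auto intro: li_Cons)
qed simp

lemma independent_map_if_inj_on:
  "independent K Us \<Longrightarrow> inj_on f (Span K Us) \<Longrightarrow> independent K (map f Us)"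
proof (induction Us)
  case (Cons u Us)
  note Us = independent_backwards[OF Cons.prems(1)]
  have carrier: "set (u # Us) \<subseteq> carrier R"
    using Cons.prems(1) by (rule independent_in_carrier)
  then have Span: "u \<in> Span K (u # Us)" "Span K Us \<subseteq> Span K (u # Us)"
    using Span_base_incl[OF K, of "u # Us"] mono_Span[OF K, of Us u] by (auto simp del: Span.simps)
  then have "f u \<notin> f ` Span K Us"
    using Cons.prems(2) Us(1) by (auto dest!: inj_onD simp del: Span.simps)
  moreover have "independent K (map f Us)"
    using Cons.IH Us(2) Cons.prems(2) Span(2) inj_on_subset by blast
  ultimately show ?case
    using carrier linear_map_Span[of Us] linear_map_closed
    by (auto intro!: li_Cons simp del: Span.simps)
qed simp

lemma dimension_linear_image_if_inj_on:
  assumes "dimension n K E" "inj_on f E"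
  shows "dimension n K (f ` E)"
proof -
  obtain Us where Us: "set Us \<subseteq> carrier R" "independent K Us" "length Us = n" "Span K Us = E"
    using exists_base[OF K assms(1)] by auto
  then have "independent K (map f Us)"
    using independent_map_if_inj_on assms(2) by blast
  from dimensionI[OF K this] show ?thesis
    using linear_map_Span[OF Us(1)] Us(3,4) by simp
qed

lemma dimension_linear_image_le:
  assumes "dimension n K E" "dimension m K (f ` E)"
  shows "m \<le> n"
proof -
  obtain Ws where Ws: "independent K Ws" "length Ws = m" "set Ws \<subseteq> f ` E"
    using exists_base[OF K assms(2)] Span_base_incl[OF K] by blast
  define Vs where "Vs = map (inv_into E f) Ws"
  have Vs: "set Vs \<subseteq> E" "map f Vs = Ws"
    using Ws(3) by (auto simp: Vs_def inv_into_into f_inv_into_f subset_iff intro: map_idI)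
  then have "independent K Vs"
    using independent_if_independent_map Ws(1) space_subgroup_props(1)[OF K assms(1)] by blast
  then show ?thesis
    using independent_length_le_dimension[OF K assms(1) _ Vs(1)] Ws(2) by (simp add: Vs_def)
qed

lemma dim_linear_image_eq_min:
  assumes fin: "finite_dimension K E" "finite_dimension K E'"
    and image_subset: "f ` E \<subseteq> E'" and inj_or_surj: "inj_on f E \<or> f ` E = E'"
  shows "dim K (f ` E) = min (dim K E) (dim K E')"
proof -
  obtain n n' where dimension: "dimension n K E" "dimension n' K E'"
    using fin by (auto simp: finite_dimension_def)
  have dim_eq: "dim K X = m" if "dimension m K X" for X m
    using dimI[OF K that] by (simp add: over_def)
  from inj_or_surj show ?thesis
  proof
    assume "inj_on f E"
    with dimension(1) have image: "dimension n K (f ` E)" by (rule dimension_linear_image_if_inj_on)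
    then have "n \<le> n'" using dimension(2) image_subset by (rule dimension_mono[OF K])
    then show ?thesis using dim_eq dimension image by simp
  next
    assume "f ` E = E'"
    then show ?thesis using dim_eq dimension dimension_linear_image_le by simp
  qed
qed

end

end

section \<open>Graded quotients of the polynomial ring\<close>

lemma mpol_ring_simps [simp]:
  "carrier mpol_ring = UNIV" "f \<otimes>\<^bsub>mpol_ring\<^esub> g = f * g" "f \<oplus>\<^bsub>mpol_ring\<^esub> g = f + g"
  "\<one>\<^bsub>mpol_ring\<^esub> = 1" "\<zero>\<^bsub>mpol_ring\<^esub> = 0"
  by (simp_all add: mpol_ring_def)

lemma cring_mpol_ring: "cring (mpol_ring :: ('n, 'k::comm_ring_1) mpol ring)"
proof (rule cringI)
  show "abelian_group (mpol_ring :: ('n, 'k) mpol ring)"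
    by (rule abelian_groupI) (auto simp: add_ac intro: exI[of _ "- f" for f])
  show "comm_monoid (mpol_ring :: ('n, 'k) mpol ring)"
    by (rule comm_monoidI) (auto simp: mult_ac)
qed (simp add: distrib_right)

interpretation mpol: cring "mpol_ring :: ('n, 'k::comm_ring_1) mpol ring"
  by (rule cring_mpol_ring)

lemma mpol_ring_a_inv [simp]:
  fixes f :: "('n, 'k::comm_ring_1) mpol"
  shows "\<ominus>\<^bsub>mpol_ring\<^esub> f = - f"
  by (rule mpol.minus_equality) auto

lemma subfield_range_mconst: "subfield (range mconst) (mpol_ring :: ('n, 'k::field) mpol ring)"
proof (rule mpol.subfieldI)
  let ?K = "range mconst :: ('n, 'k) mpol set" and ?R = "mpol_ring :: ('n, 'k) mpol ring"
  have uminus: "- mconst a = (mconst (- a) :: ('n, 'k) mpol)" for a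
    by (simp add: mconst_def single_uminus)
  show "subcring ?K ?R"
  proof (rule mpol.subcringI'[OF mpol.subringI])
    show "\<one>\<^bsub>?R\<^esub> \<in> ?K" using mconst_1 by (metis mpol_ring_simps(4) rangeI)
  qed (auto simp: uminus simp flip: mconst_mult mconst_add)
  have "mconst a \<in> Units (?R\<lparr>carrier := ?K\<rparr>)" if "a \<noteq> 0" for a
  proof -
    have "mconst (inverse a) * mconst a = 1" "mconst a * mconst (inverse a) = 1"
      using that by (simp_all flip: mconst_mult)
    then show ?thesis unfolding Units_def by auto
  qed
  moreover have "0 \<notin> Units (?R\<lparr>carrier := ?K\<rparr>)"
    by (simp add: Units_def)
  moreover have "Units (?R\<lparr>carrier := ?K\<rparr>) \<subseteq> ?K"
    by (auto simp: Units_def)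
  ultimately show "Units (?R\<lparr>carrier := ?K\<rparr>) = ?K - {\<zero>\<^bsub>?R\<^esub>}"
    by (auto, metis mconst_0)
qed

lemma subalgebra_homogeneous_part:
  "subalgebra (range mconst) (homogeneous_part d) (mpol_ring :: ('n::finite, 'k::field) mpol ring)"
proof (intro subalgebra.intro subalgebra_axioms.intro)
  show "subgroup (homogeneous_part d) (add_monoid (mpol_ring :: ('n, 'k) mpol ring))"
  proof (rule mpol.add.subgroupI)
    fix f :: "('n, 'k) mpol" assume "f \<in> homogeneous_part d"
    then show "\<ominus>\<^bsub>mpol_ring\<^esub> f \<in> homogeneous_part d"
      by (simp add: homogeneous_part_iff)
  qed (auto simp: homogeneous_part_add intro: zero_in_homogeneous_part)
qed (auto simp: homogeneous_part_mconst_mult)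

lemma homogeneous_part_eq_Span:
  obtains Us :: "('n::finite, 'k::field) mpol list"
  where "homogeneous_part d = mpol.Span (range mconst) Us"
proof -
  obtain ms where ms: "set ms = {m :: 'n \<Rightarrow>\<^sub>0 nat. mdegree m = d}"
    using finite_list[OF finite_mdegree] by blast
  let ?Us = "map (\<lambda>m. Poly_Mapping.single m 1) ms :: ('n, 'k) mpol list"
  have "homogeneous_part d = mpol.Span (range mconst) ?Us"
  proof (rule mpol.Span_subalgebraI[OF subfield_range_mconst subalgebra_homogeneous_part])
    show "set ?Us \<subseteq> homogeneous_part d"
      using ms by (auto intro: single_in_homogeneous_part)
    fix V :: "('n, 'k) mpol set"
    assume V: "subalgebra (range mconst) V mpol_ring" "set ?Us \<subseteq> V"
    have single: "Poly_Mapping.single m a \<in> V" if "mdegree m = d" for m a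
      using subalgebra.smult_closed[OF V(1), of "mconst a" "Poly_Mapping.single m 1"] V(2) ms that
      by (auto simp: mconst_mult_single)
    have "f \<in> homogeneous_part d \<Longrightarrow> f \<in> V" for f
    proof (induction f rule: update_induct)
      case const
      show ?case using subgroup.one_closed[OF subalgebra.axioms(1)[OF V(1)]] by simp
    next
      case (update f m a)
      have "mdegree m = d" "f \<in> homogeneous_part d"
        using update.prems update.hyps(1,2)
        by (auto simp: homogeneous_part_iff lookup_update in_keys_iff split: if_splits)
      then show ?case
        using subgroup.m_closed[OF subalgebra.axioms(1)[OF V(1)]] single update.IH
        by (simp add: update_eq_single_add[OF update.hyps(1)])
    qed
    then show "homogeneous_part d \<subseteq> V" by blast
  qed
  then show ?thesis by (rule that)
qed

locale proper_mpol_ideal = ideal I mpol_ring for I :: "('n::finite, 'k::field) mpol set" +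
  assumes one_notin: "1 \<notin> I"
begin

abbreviation Q where "Q \<equiv> mpol_ring Quot I"
abbreviation residue where "residue f \<equiv> I +>\<^bsub>mpol_ring\<^esub> f"

sublocale Q: cring Q
  by (rule quotient_is_cring[OF cring_mpol_ring])

sublocale residue: ring_hom_ring mpol_ring Q residue
  by (rule rcos_ring_hom_ring)

lemma residue_eq_iff: "residue f = residue g \<longleftrightarrow> f - g \<in> I"
  using mpol.quotient_eq_iff_same_a_r_cos[OF ideal_axioms, of f g] by (simp add: a_minus_def)

lemma residue_in_carrier: "residue f \<in> carrier Q"
  using residue.hom_closed[of f] by simp

lemma residue_mult: "residue f \<otimes>\<^bsub>Q\<^esub> residue g = residue (f * g)"
  using residue.hom_mult[of f g] by simp

lemma residue_power: "residue f [^]\<^bsub>Q\<^esub> (j::nat) = residue (f ^ j)"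
proof (induction j)
  case 0
  show ?case using residue.hom_one by simp
qed (simp add: residue_mult mult.commute)

lemma quot_scalars_eq: "quot_scalars I = residue ` range mconst"
  by (simp add: quot_scalars_def image_image)

lemma subfield_quot_scalars: "subfield (quot_scalars I) Q"
proof -
  have "residue 1 \<noteq> residue 0" by (simp add: residue_eq_iff one_notin)
  then have "\<one>\<^bsub>Q\<^esub> \<noteq> \<zero>\<^bsub>Q\<^esub>"
    using residue.hom_one residue.hom_zero by simp
  then show ?thesis
    unfolding quot_scalars_eq by (rule residue.img_is_subfield(2)[OF subfield_range_mconst])
qed

lemma finite_dimension_quot_part: "Q.finite_dimension (quot_scalars I) (quot_part I d)"
proof -
  obtain Us where Us: "homogeneous_part d = mpol.Span (range mconst) (Us :: ('n, 'k) mpol list)"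
    by (rule homogeneous_part_eq_Span)
  have "quot_part I d = Q.Span (quot_scalars I) (map residue Us)"
    unfolding quot_part_def quot_scalars_eq Us by (rule residue.Span_hom[symmetric]) auto
  moreover have "set (map residue Us) \<subseteq> carrier Q"
    by (auto simp: residue_in_carrier)
  ultimately show ?thesis
    using Q.Span_finite_dimension[OF subfield_quot_scalars] by metis
qed

lemma linear_map_mult: "a \<in> carrier Q \<Longrightarrow> Q.linear_map (quot_scalars I) ((\<otimes>\<^bsub>Q\<^esub>) a)"
  using subfieldE(3)[OF subfield_quot_scalars]
  by (auto simp: Q.linear_map_def Q.r_distr Q.m_lcomm subset_iff)

lemma mult_power_map_residue: "mult_power_map I l j (residue f) = residue (l ^ j * f)"
  by (simp add: mult_power_map_def residue_power residue_mult)

context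
  fixes l :: "('n, 'k) mpol" and i j :: nat
  assumes l: "l \<in> homogeneous_part 1"
begin

lemma mult_power_map_quot_part: "mult_power_map I l j ` quot_part I i \<subseteq> quot_part I (i + j)"
proof -
  have "l ^ j * f \<in> homogeneous_part (i + j)" if "f \<in> homogeneous_part i" for f
    using homogeneous_part_mult[OF homogeneous_part_power[OF l, of j] that] by (simp add: add.commute)
  then show ?thesis
    by (auto simp: quot_part_def mult_power_map_residue)
qed

lemma mult_power_max_rank_if_inj_or_surj:
  assumes "inj_on (mult_power_map I l j) (quot_part I i) \<or>
    mult_power_map I l j ` quot_part I i = quot_part I (i + j)"
  shows "mult_power_max_rank I l j i"
proof -
  have "mult_power_map I l j = (\<otimes>\<^bsub>Q\<^esub>) (residue (l ^ j))"
    by (simp add: fun_eq_iff mult_power_map_def residue_power)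
  then have "Q.linear_map (quot_scalars I) (mult_power_map I l j)"
    by (simp add: linear_map_mult residue_in_carrier)
  then show ?thesis
    unfolding mult_power_max_rank_def quot_dim_def
    by (intro Q.dim_linear_image_eq_min subfield_quot_scalars finite_dimension_quot_part
        mult_power_map_quot_part assms)
qed

lemma mult_power_max_rank_injI:
  assumes "\<And>f. f \<in> homogeneous_part i \<Longrightarrow> l ^ j * f \<in> I \<Longrightarrow> f \<in> I"
  shows "mult_power_max_rank I l j i"
proof (rule mult_power_max_rank_if_inj_or_surj, rule disjI1, rule inj_onI)
  fix x y assume "x \<in> quot_part I i" "y \<in> quot_part I i"
    and eq: "mult_power_map I l j x = mult_power_map I l j y"
  then obtain f g where fg: "f \<in> homogeneous_part i" "g \<in> homogeneous_part i"
    and xy: "x = residue f" "y = residue g"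
    by (auto simp: quot_part_def)
  have "l ^ j * (f - g) \<in> I"
    using eq by (simp add: xy mult_power_map_residue residue_eq_iff right_diff_distrib)
  then have "f - g \<in> I" using assms homogeneous_part_minus[OF fg] by blast
  then show "x = y" by (simp add: xy residue_eq_iff)
qed

lemma mult_power_max_rank_surjI:
  assumes "\<And>g. g \<in> homogeneous_part (i + j) \<Longrightarrow> \<exists>f\<in>homogeneous_part i. g - l ^ j * f \<in> I"
  shows "mult_power_max_rank I l j i"
proof (rule mult_power_max_rank_if_inj_or_surj, rule disjI2, rule antisym)
  show "quot_part I (i + j) \<subseteq> mult_power_map I l j ` quot_part I i"
  proof
    fix y assume "y \<in> quot_part I (i + j)"
    then obtain g where g: "g \<in> homogeneous_part (i + j)" "y = residue g"
      by (auto simp: quot_part_def)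
    then obtain f where "f \<in> homogeneous_part i" "g - l ^ j * f \<in> I"
      using assms by blast
    then show "y \<in> mult_power_map I l j ` quot_part I i"
      unfolding quot_part_def image_image mult_power_map_residue
      using g(2) residue_eq_iff by blast
  qed
qed (rule mult_power_map_quot_part)

end

end

section \<open>Lefschetz properties of annihilators\<close>

lemma in_ann_iff: "g \<in> ann F \<longleftrightarrow> diff_act g F = 0"
  by (simp add: ann_def)

lemma ideal_ann: "ideal (ann F) (mpol_ring :: ('n::finite, 'k::comm_ring_1) mpol ring)"
proof (rule idealI)
  show "subgroup (ann F) (add_monoid mpol_ring)"
  proof (rule mpol.add.subgroupI)
    have "0 \<in> ann F" by (simp add: in_ann_iff)
    then show "ann F \<noteq> {}" by blast
    show "\<ominus>\<^bsub>mpol_ring\<^esub> f \<in> ann F" if "f \<in> ann F" for f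
      using that diff_act_minus_left[of 0 f F] by (simp add: in_ann_iff)
  qed (auto simp: in_ann_iff diff_act_add_left)
  fix f g assume "f \<in> ann F"
  then show "g \<otimes>\<^bsub>mpol_ring\<^esub> f \<in> ann F"
    by (simp add: in_ann_iff diff_act_mult)
  then show "f \<otimes>\<^bsub>mpol_ring\<^esub> g \<in> ann F" by (simp add: mult.commute)
qed (rule mpol.ring_axioms)

lemma proper_mpol_ideal_ann:
  fixes F :: "('n::finite, 'k::field) mpol"
  assumes "F \<noteq> 0"
  shows "proper_mpol_ideal (ann F)"
  using assms by (simp add: proper_mpol_ideal_def proper_mpol_ideal_axioms_def ideal_ann in_ann_iff)

lemma mult_power_max_rank_0:
  assumes "proper_mpol_ideal I" "l \<in> homogeneous_part 1"
  shows "mult_power_max_rank I l 0 i"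
  using assms by (intro proper_mpol_ideal.mult_power_max_rank_injI) auto

lemma mult_power_max_rank_above_socle_degree:
  fixes F :: "('n::finite, 'k::field) mpol"
  assumes "F \<in> homogeneous_part d" "F \<noteq> 0" "l \<in> homogeneous_part 1" "d < i + j"
  shows "mult_power_max_rank (ann F) l j i"
proof (rule proper_mpol_ideal.mult_power_max_rank_surjI)
  fix g :: "('n, 'k) mpol" assume "g \<in> homogeneous_part (i + j)"
  then have "g - l ^ j * 0 \<in> ann F"
    using assms by (simp add: in_ann_iff diff_act_eq_0_if_degree_less)
  then show "\<exists>f\<in>homogeneous_part i. g - l ^ j * f \<in> ann F"
    using zero_in_homogeneous_part by blast
qed (use assms proper_mpol_ideal_ann in auto)

context
  fixes F :: "('n::finite, 'k::field_char_0) mpol" and d :: nat and c :: "'n \<Rightarrow> 'k"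
  assumes F: "F \<in> homogeneous_part d" and Fc: "meval c F \<noteq> 0"
begin

lemma proper_mpol_ideal_ann_nonzero: "proper_mpol_ideal (ann F)"
  using Fc by (intro proper_mpol_ideal_ann) auto

lemma mult_power_max_rank_into_socle:
  assumes "i + j = d"
  shows "mult_power_max_rank (ann F) (linear_form c) j i"
proof (rule proper_mpol_ideal.mult_power_max_rank_surjI)
  let ?l = "linear_form c"
  fix g :: "('n, 'k) mpol" assume "g \<in> homogeneous_part (i + j)"
  then have "diff_act g F \<in> homogeneous_part 0"
    using F assms by (simp add: homogeneous_part_diff_act)
  then obtain a where a: "diff_act g F = mconst a" by (rule homogeneous_part_0E)
  define f where "f = mconst (a / (fact d * meval c F)) * ?l ^ i"
  have "?l ^ i \<in> homogeneous_part (i * 1)"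
    by (intro homogeneous_part_power linear_form_in_homogeneous_part)
  then have "f \<in> homogeneous_part i"
    by (simp add: f_def homogeneous_part_mconst_mult)
  moreover have "?l ^ j * f = mconst (a / (fact d * meval c F)) * ?l ^ d"
    by (simp add: f_def power_add mult_ac flip: assms)
  then have "diff_act (g - ?l ^ j * f) F = 0"
    using F Fc
    by (simp add: a diff_act_minus_left diff_act_mult diff_act_linear_form_power flip: mconst_mult)
  ultimately show "\<exists>f\<in>homogeneous_part i. g - ?l ^ j * f \<in> ann F"
    by (auto simp: in_ann_iff)
qed (use proper_mpol_ideal_ann_nonzero linear_form_in_homogeneous_part in auto)

lemma mult_power_max_rank_from_constants:
  assumes "j \<le> d"
  shows "mult_power_max_rank (ann F) (linear_form c) j 0"
proof (rule proper_mpol_ideal.mult_power_max_rank_injI)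
  let ?l = "linear_form c"
  fix f :: "('n, 'k) mpol"
  assume f: "f \<in> homogeneous_part 0" and ann: "?l ^ j * f \<in> ann F"
  from f obtain a where a: "f = mconst a" by (rule homogeneous_part_0E)
  have "?l ^ (d - j) * (?l ^ j * f) = mconst a * ?l ^ d"
    using assms by (simp add: a mult_ac flip: power_add)
  then have "mconst a * diff_act (?l ^ d) F = 0"
    using ann by (metis diff_act_0_right diff_act_mconst diff_act_mult in_ann_iff)
  then have "mconst (a * (fact d * meval c F)) = (0 :: ('n, 'k) mpol)"
    using F by (simp add: diff_act_linear_form_power mconst_mult)
  then have "a * (fact d * meval c F) = 0" by (metis meval_0 meval_mconst)
  then show "f \<in> ann F" using Fc by (simp add: a in_ann_iff)
qed (use proper_mpol_ideal_ann_nonzero linear_form_in_homogeneous_part in auto)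

end

section \<open>Hessian matrices\<close>

definition hessian :: "('n::finite, 'k::comm_semiring_1) mpol \<Rightarrow> ('n, 'k) mpol ^ 'n ^ 'n" where
  "hessian F = (\<chi> i j. mderiv i (mderiv j F))"

lemma hessian_mult_vec_nth:
  "(map_matrix (meval c) (hessian F) *v v) $ i = meval c (mderiv i (diff_act (linear_form (($) v)) F))"
proof -
  have "(map_matrix (meval c) (hessian F) *v v) $ i = (\<Sum>j\<in>UNIV. v $ j * meval c (mderiv i (mderiv j F)))"
    by (simp add: hessian_def matrix_vector_mult_def mult.commute)
  then show ?thesis
    by (simp add: diff_act_linear_form mderiv_sum mderiv_mconst_mult meval_sum meval_mult)
qed

lemma homogeneous_1_eq_0_if_meval_eq_0:
  fixes f :: "('n::finite, 'k::comm_semiring_1) mpol"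
  assumes "f \<in> homogeneous_part 1" "\<And>c. meval c f = 0"
  shows "f = 0"
proof -
  obtain v where v: "f = linear_form v" using assms(1) by (rule homogeneous_part_1E)
  have "meval (\<lambda>i. of_bool (i = j)) f = v j" for j
    by (simp add: v linear_form_def meval_sum meval_mult of_bool_def if_distrib cong: if_cong)
  then have "v j = 0" for j using assms(2) by metis
  then show ?thesis by (simp add: v linear_form_def)
qed

lemma linear_form_in_ann_if_hessian_mult_vec_eq_0:
  fixes F :: "('n::finite, 'k::field_char_0) mpol"
  assumes F: "F \<in> homogeneous_part 3" and ker: "\<And>c. map_matrix (meval c) (hessian F) *v v = 0"
  shows "linear_form (($) v) \<in> ann F"
proof -
  let ?G = "diff_act (linear_form (($) v)) F"
  have "F \<in> homogeneous_part (Suc 1 + 1)" using F by simp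
  then have G: "?G \<in> homogeneous_part (Suc 1)"
    using linear_form_in_homogeneous_part by (rule homogeneous_part_diff_act)
  have "meval c (mderiv i ?G) = 0" for c i
    using ker[of c] by (simp flip: hessian_mult_vec_nth)
  then have "mderiv i ?G = 0" for i
    using homogeneous_part_mderiv[OF G] homogeneous_1_eq_0_if_meval_eq_0 by blast
  then show ?thesis
    using homogeneous_eq_0_if_mderiv_eq_0[OF G] by (simp add: in_ann_iff)
qed

lemma mult_power_max_rank_from_degree_1:
  fixes F :: "('n::finite, 'k::field_char_0) mpol"
  assumes F: "F \<in> homogeneous_part (d + 2)" "F \<noteq> 0"
    and ker: "\<And>v. map_matrix (meval c) (hessian F) *v v = 0 \<Longrightarrow> linear_form (($) v) \<in> ann F"
  shows "mult_power_max_rank (ann F) (linear_form c) d 1"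
proof (rule proper_mpol_ideal.mult_power_max_rank_injI)
  fix f :: "('n, 'k) mpol"
  assume f: "f \<in> homogeneous_part 1" and ann: "linear_form c ^ d * f \<in> ann F"
  obtain u where "f = linear_form u" using f by (rule homogeneous_part_1E)
  then obtain v :: "'k ^ 'n" where v: "f = linear_form (($) v)"
    by (metis vec_lambda_inverse UNIV_I)
  have "diff_act f F \<in> homogeneous_part (Suc d)"
    using F(1) f by (intro homogeneous_part_diff_act[where e = 1]) (simp_all add: One_nat_def)
  then have "mderiv i (diff_act f F) \<in> homogeneous_part d" for i
    by (rule homogeneous_part_mderiv)
  then have "mconst (fact d * meval c (mderiv i (diff_act f F))) =
      mderiv i (diff_act (linear_form c ^ d * f) F)" for i
    by (simp only: diff_act_mult mderiv_diff_act[of i "linear_form c ^ d"] diff_act_linear_form_power)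
  then have "fact d * meval c (mderiv i (diff_act f F)) = 0" for i
    using ann by (metis in_ann_iff mderiv_0 meval_0 meval_mconst)
  then have "map_matrix (meval c) (hessian F) *v v = 0"
    by (simp add: vec_eq_iff hessian_mult_vec_nth v)
  then show "f \<in> ann F" unfolding v by (rule ker)
qed (use F proper_mpol_ideal_ann linear_form_in_homogeneous_part in auto)

lemma matrix_generalized_inverse:
  fixes A :: "'k::field ^ 'm ^ 'l"
  obtains B where "A ** B ** A = A"
proof -
  obtain g where g: "Vector_Spaces.linear (*s) (*s) g" "\<And>x. A *v g (A *v x) = A *v x"
    using vec.linear_exists_right_inverse_on[OF matrix_vector_mul_linear_gen[of A] vec.subspace_UNIV]
    by auto
  then have "(A ** matrix g ** A) *v x = A *v x" for x
    by (simp add: matrix_works flip: matrix_vector_mul_assoc)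
  then have "A ** matrix g ** A = A" by (simp add: matrix_eq)
  then show ?thesis by (rule that)
qed

text \<open>
  The determinant of \<open>P = 1 + B (A - A(c0))\<close> serves as \<open>G\<close>: on the kernel of \<open>A(c)\<close>, the matrix \<open>P(c)\<close>
  coincides with the projection \<open>1 - B A(c0)\<close> onto the kernel of \<open>A(c0)\<close>.
\<close>

lemma generic_kernel:
  fixes A :: "('n::finite, 'k::field) mpol ^ 'm ^ 'l"
  assumes ker: "\<And>c v. map_matrix (meval c0) A *v v = 0 \<Longrightarrow> map_matrix (meval c) A *v v = 0"
  obtains G where "meval c0 G \<noteq> 0"
    and "\<And>c v. meval c G \<noteq> 0 \<Longrightarrow> map_matrix (meval c) A *v v = 0 \<Longrightarrow> map_matrix (meval c0) A *v v = 0"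
proof -
  let ?A = "\<lambda>c. map_matrix (meval c) A"
  obtain B where B: "?A c0 ** B ** ?A c0 = ?A c0" by (rule matrix_generalized_inverse)
  define P where "P = mat 1 + map_matrix mconst B ** (A - map_matrix mconst (?A c0))"
  have P: "map_matrix (meval c) P = mat 1 + B ** (?A c - ?A c0)" for c
    by (simp add: P_def vec_eq_iff mat_def matrix_matrix_mult_def meval_add meval_sum meval_mult
        meval_minus)
  have P_mult_vec: "map_matrix (meval c) P *v x = x + B *v (?A c *v x) - B *v (?A c0 *v x)" for c x
    by (simp add: P matrix_vector_mult_add_rdistrib matrix_vector_mult_diff_rdistrib
        matrix_vector_mult_diff_distrib flip: matrix_vector_mul_assoc)
  show ?thesis
  proof
    show "meval c0 (det P) \<noteq> 0" by (simp add: meval_det P)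
    fix c v assume c: "meval c (det P) \<noteq> 0" and v: "?A c *v v = 0"
    define u where "u = v - B *v (?A c0 *v v)"
    have "?A c0 *v u = 0"
      by (simp add: u_def matrix_vector_mult_diff_distrib matrix_vector_mul_assoc matrix_mul_assoc B)
    moreover have "?A c *v u = 0"
      using \<open>?A c0 *v u = 0\<close> by (rule ker)
    ultimately have "map_matrix (meval c) P *v (v - u) = 0"
      using v by (simp add: P_mult_vec matrix_vector_mult_diff_distrib) (simp add: u_def)
    moreover have "invertible (map_matrix (meval c) P)"
      using c by (simp add: meval_det invertible_det_nz)
    ultimately have "v = u"
      by (metis eq_iff_diff_eq_0 invertible_left_inverse matrix_left_invertible_ker)
    with \<open>?A c0 *v u = 0\<close> show "?A c0 *v v = 0" by simp
  qed
qed

lemma strong_lefschetz_if_generic: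
  assumes "meval c0 G \<noteq> 0"
    and "\<And>c i j. meval c G \<noteq> 0 \<Longrightarrow> mult_power_max_rank I (linear_form c) j i"
  shows "strong_lefschetz I"
  unfolding strong_lefschetz_def
proof (intro exI conjI)
  show "zariski_open {c. meval c G \<noteq> 0}"
    unfolding zariski_open_def by (rule exI[of _ "{G}"]) simp
qed (use assms in auto)

lemma cubic_mult_power_max_rank:
  fixes F :: "('n::finite, 'k::field_char_0) mpol"
  assumes F: "F \<in> homogeneous_part 3" "meval c F \<noteq> 0"
    and ker: "\<And>v. map_matrix (meval c) (hessian F) *v v = 0 \<Longrightarrow> linear_form (($) v) \<in> ann F"
  shows "mult_power_max_rank (ann F) (linear_form c) j i"
proof -
  have "F \<noteq> 0" using F(2) by auto
  consider (identity) "j = 0" | (above_socle) "3 < i + j" | (into_socle) "i + j = 3"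
    | (from_constants) "i = 0" "j \<le> 3" | (middle) "i = 1" "j = 1"
    by linarith
  then show ?thesis
  proof cases
    case identity
    then show ?thesis
      using mult_power_max_rank_0[OF proper_mpol_ideal_ann[OF \<open>F \<noteq> 0\<close>]]
        linear_form_in_homogeneous_part by auto
  next
    case above_socle
    with F(1) \<open>F \<noteq> 0\<close> linear_form_in_homogeneous_part show ?thesis
      by (rule mult_power_max_rank_above_socle_degree)
  next
    case into_socle
    with F show ?thesis by (rule mult_power_max_rank_into_socle)
  next
    case from_constants
    then show ?thesis using mult_power_max_rank_from_constants[OF F] by simp
  next
    case middle
    then show ?thesis using mult_power_max_rank_from_degree_1[of F 1 c] F(1) \<open>F \<noteq> 0\<close> ker by simp
  qed
qed

theorem cubic_hessian_criterion:
  fixes F :: "('n::finite, 'k::field_char_0) mpol"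
  assumes F: "F \<in> homogeneous_part 3" "meval c0 F \<noteq> 0"
    and ker: "\<And>c v. map_matrix (meval c0) (hessian F) *v v = 0 \<Longrightarrow>
      map_matrix (meval c) (hessian F) *v v = 0"
  shows "strong_lefschetz (ann F)"
proof -
  obtain G where G: "meval c0 G \<noteq> 0" and generic: "\<And>c v. meval c G \<noteq> 0 \<Longrightarrow>
      map_matrix (meval c) (hessian F) *v v = 0 \<Longrightarrow> map_matrix (meval c0) (hessian F) *v v = 0"
    using generic_kernel[OF ker] by blast
  show ?thesis
  proof (rule strong_lefschetz_if_generic)
    show "meval c0 (F * G) \<noteq> 0" using F(2) G by (simp add: meval_mult)
    fix c i j assume "meval c (F * G) \<noteq> 0"
    then have "meval c F \<noteq> 0" "meval c G \<noteq> 0" by (auto simp: meval_mult)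
    moreover from this have "linear_form (($) v) \<in> ann F"
      if "map_matrix (meval c) (hessian F) *v v = 0" for v
      using generic ker that by (intro linear_form_in_ann_if_hessian_mult_vec_eq_0[OF F(1)]) blast
    ultimately show "mult_power_max_rank (ann F) (linear_form c) j i"
      using F(1) by (intro cubic_mult_power_max_rank)
  qed
qed

section \<open>Symmetric cubic forms\<close>

text \<open>
  The general symmetric cubic, with coefficients adapted to the splitting \<open>c = y + m\<close> of a point
  into its mean \<open>m\<close> and its deviation \<open>y\<close>: see \<open>meval_centered_cubic\<close>.
\<close>

definition centered_cubic :: "'k \<Rightarrow> 'k \<Rightarrow> 'k \<Rightarrow> ('n::finite, 'k::comm_ring_1) mpol" where
  "centered_cubic d b a = mconst (d - b + 2 * a) * power_sum 1 ^ 3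
     + mconst (b - 3 * a) * of_nat CARD('n) * power_sum 1 * power_sum 2
     + mconst a * of_nat CARD('n) ^ 2 * power_sum 3"

lemma centered_cubic_in_homogeneous_part:
  "(centered_cubic d b a :: ('n::finite, 'k::comm_ring_1) mpol) \<in> homogeneous_part 3"
proof -
  let ?p = "power_sum :: nat \<Rightarrow> ('n, 'k) mpol"
  have "?p 1 ^ 3 \<in> homogeneous_part (3 * 1)" "?p 1 * ?p 2 \<in> homogeneous_part (1 + 2)"
    by (intro homogeneous_part_power homogeneous_part_mult power_sum_in_homogeneous_part)+
  then have "?p 1 ^ 3 \<in> homogeneous_part 3" "?p 1 * ?p 2 \<in> homogeneous_part 3"
    by simp_all
  moreover have "centered_cubic d b a = mconst (d - b + 2 * a) * ?p 1 ^ 3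
      + mconst ((b - 3 * a) * of_nat CARD('n)) * (?p 1 * ?p 2)
      + mconst (a * of_nat CARD('n) ^ 2) * ?p 3"
    by (simp add: centered_cubic_def mconst_mult mconst_of_nat power2_eq_square mult.assoc)
  ultimately show ?thesis
    by (simp add: homogeneous_part_add homogeneous_part_mconst_mult power_sum_in_homogeneous_part)
qed

lemma sum_shifted_squares:
  fixes y :: "'n::finite \<Rightarrow> 'k::comm_ring_1"
  assumes "sum y UNIV = 0"
  shows "(\<Sum>i\<in>UNIV. (y i + m) ^ 2) = (\<Sum>i\<in>UNIV. y i ^ 2) + of_nat CARD('n) * m ^ 2"
proof -
  have "(\<Sum>i\<in>UNIV. (y i + m) ^ 2) = (\<Sum>i\<in>UNIV. y i ^ 2 + 2 * m * y i + m ^ 2)"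
    by (intro sum.cong) (simp_all add: power2_eq_square algebra_simps)
  also have "\<dots> = (\<Sum>i\<in>UNIV. y i ^ 2) + 2 * m * sum y UNIV + of_nat CARD('n) * m ^ 2"
    by (simp add: sum.distrib sum_distrib_left)
  finally show ?thesis by (simp add: assms)
qed

lemma sum_shifted_cubes:
  fixes y :: "'n::finite \<Rightarrow> 'k::comm_ring_1"
  assumes "sum y UNIV = 0"
  shows "(\<Sum>i\<in>UNIV. (y i + m) ^ 3) =
    (\<Sum>i\<in>UNIV. y i ^ 3) + 3 * m * (\<Sum>i\<in>UNIV. y i ^ 2) + of_nat CARD('n) * m ^ 3"
proof -
  have "(\<Sum>i\<in>UNIV. (y i + m) ^ 3) = (\<Sum>i\<in>UNIV. y i ^ 3 + 3 * m * y i ^ 2 + 3 * m ^ 2 * y i + m ^ 3)"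
    by (intro sum.cong) (simp_all add: power2_eq_square power3_eq_cube algebra_simps)
  also have "\<dots> = (\<Sum>i\<in>UNIV. y i ^ 3) + 3 * m * (\<Sum>i\<in>UNIV. y i ^ 2)
      + 3 * m ^ 2 * sum y UNIV + of_nat CARD('n) * m ^ 3"
    by (simp add: sum.distrib sum_distrib_left)
  finally show ?thesis by (simp add: assms)
qed

lemma meval_centered_cubic:
  fixes y :: "'n::finite \<Rightarrow> 'k::comm_ring_1"
  assumes "sum y UNIV = 0"
  shows "meval (\<lambda>i. y i + m) (centered_cubic d b a) = of_nat CARD('n) ^ 2 *
    (of_nat CARD('n) * d * m ^ 3 + b * m * (\<Sum>i\<in>UNIV. y i ^ 2) + a * (\<Sum>i\<in>UNIV. y i ^ 3))"
proof -
  have "(\<Sum>i\<in>UNIV. y i + m) = of_nat CARD('n) * m"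
    by (simp add: sum.distrib assms)
  then show ?thesis
    by (simp add: centered_cubic_def meval_add meval_mult meval_power meval_power_sum
        sum_shifted_squares[OF assms] sum_shifted_cubes[OF assms])
      (simp add: power2_eq_square power3_eq_cube algebra_simps)
qed

lemma meval_mderiv_mderiv_centered_cubic:
  fixes c :: "'n::finite \<Rightarrow> 'k::comm_ring_1"
  shows "meval c (mderiv i (mderiv j (centered_cubic d b a))) =
    6 * (d - b + 2 * a) * sum c UNIV
      + 2 * (b - 3 * a) * of_nat CARD('n) * (c i + c j + of_bool (i = j) * sum c UNIV)
      + 6 * a * of_nat CARD('n) ^ 2 * (of_bool (i = j) * c i)"
  by (simp add: centered_cubic_def mderiv_add mderiv_mult mderiv_power mderiv_power_sum mderiv_mvar
      meval_add meval_mult meval_power meval_power_sum)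
    (simp add: power2_eq_square algebra_simps of_bool_def)

lemma hessian_centered_cubic_mult_vec_nth:
  fixes c :: "'n::finite \<Rightarrow> 'k::comm_ring_1"
  shows "(map_matrix (meval c) (hessian (centered_cubic d b a)) *v v) $ i =
    6 * (d - b + 2 * a) * sum c UNIV * sum (($) v) UNIV
      + 2 * (b - 3 * a) * of_nat CARD('n) *
        (c i * sum (($) v) UNIV + (\<Sum>j\<in>UNIV. c j * v $ j) + sum c UNIV * v $ i)
      + 6 * a * of_nat CARD('n) ^ 2 * (c i * v $ i)"
proof -
  let ?n = "of_nat CARD('n) :: 'k"
  have "(map_matrix (meval c) (hessian (centered_cubic d b a)) *v v) $ i =
    (\<Sum>j\<in>UNIV. (6 * (d - b + 2 * a) * sum c UNIV + 2 * (b - 3 * a) * ?n * c i) * v $ j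
      + 2 * (b - 3 * a) * ?n * (c j * v $ j)
      + (if i = j then (2 * (b - 3 * a) * ?n * sum c UNIV + 6 * a * ?n ^ 2 * c i) * v $ i else 0))"
    unfolding matrix_vector_mult_def hessian_def
    by (auto simp: meval_mderiv_mderiv_centered_cubic algebra_simps intro!: sum.cong)
  also have "\<dots> = (6 * (d - b + 2 * a) * sum c UNIV + 2 * (b - 3 * a) * ?n * c i) * sum (($) v) UNIV
      + 2 * (b - 3 * a) * ?n * (\<Sum>j\<in>UNIV. c j * v $ j)
      + (2 * (b - 3 * a) * ?n * sum c UNIV + 6 * a * ?n ^ 2 * c i) * v $ i"
    by (simp add: sum.distrib flip: sum_distrib_left)
  finally show ?thesis by (simp add: algebra_simps)
qed

lemma centered_cubic_hessian_kernel_iff: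
  fixes y w :: "'n::finite \<Rightarrow> 'k::field_char_0"
  assumes y: "sum y UNIV = 0" and w: "sum w UNIV = 0"
  defines "q \<equiv> \<Sum>i\<in>UNIV. y i * w i"
  shows "map_matrix (meval (\<lambda>i. y i + m)) (hessian (centered_cubic d b a)) *v (\<chi> i. w i + \<mu>) = 0 \<longleftrightarrow>
    3 * of_nat CARD('n) * d * m * \<mu> + b * q = 0 \<and>
    (\<forall>i. of_nat CARD('n) * (b * (m * w i + \<mu> * y i) + 3 * a * (y i * w i)) = 3 * a * q)"
    (is "?lhs \<longleftrightarrow> ?mean = 0 \<and> (\<forall>i. ?dev i = 3 * a * q)")
proof -
  let ?n = "of_nat CARD('n) :: 'k"
  have sums: "(\<Sum>i\<in>UNIV. y i + m) = ?n * m" "(\<Sum>i\<in>UNIV. w i + \<mu>) = ?n * \<mu>"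
    by (simp_all add: sum.distrib y w)
  have "(\<Sum>j\<in>UNIV. (y j + m) * (w j + \<mu>)) = (\<Sum>j\<in>UNIV. y j * w j + \<mu> * y j + m * w j + m * \<mu>)"
    by (intro sum.cong) (simp_all add: algebra_simps)
  also have "\<dots> = q + ?n * m * \<mu>"
    by (simp add: sum.distrib y w q_def flip: sum_distrib_left)
  finally have inner: "(\<Sum>j\<in>UNIV. (y j + m) * (w j + \<mu>)) = q + ?n * m * \<mu>" .
  have nth: "(map_matrix (meval (\<lambda>i. y i + m)) (hessian (centered_cubic d b a)) *v (\<chi> i. w i + \<mu>)) $ i =
      2 * ?n * (?mean + (?dev i - 3 * a * q))" for i
    unfolding hessian_centered_cubic_mult_vec_nth vec_lambda_beta sums inner
    by (simp add: algebra_simps power2_eq_square)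
  have lhs_iff: "?lhs \<longleftrightarrow> (\<forall>i. ?mean + (?dev i - 3 * a * q) = 0)"
    by (simp add: vec_eq_iff nth)
  have "(\<Sum>i\<in>UNIV. ?dev i) = ?n * (b * (m * sum w UNIV + \<mu> * sum y UNIV) + 3 * a * q)"
    unfolding q_def sum_distrib_left by (simp add: sum.distrib sum_distrib_left algebra_simps)
  then have "(\<Sum>i\<in>UNIV. ?mean + (?dev i - 3 * a * q)) = ?n * ?mean"
    by (simp add: sum.distrib sum_subtractf y w)
  then have "?mean = 0" if "\<forall>i. ?mean + (?dev i - 3 * a * q) = 0"
    using that by simp
  then show ?thesis unfolding lhs_iff by (metis add_0 eq_iff_diff_eq_0)
qed

lemma mean_decomposition:
  fixes c :: "'n::finite \<Rightarrow> 'k::field_char_0"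
  obtains y m where "c = (\<lambda>i. y i + m)" "sum y UNIV = 0"
proof
  let ?m = "sum c UNIV / of_nat CARD('n)"
  show "c = (\<lambda>i. (c i - ?m) + ?m)" by simp
  show "(\<Sum>i\<in>UNIV. c i - ?m) = 0" by (simp add: sum_subtractf)
qed

lemma strong_lefschetz_centered_cubicI:
  fixes y :: "'n::finite \<Rightarrow> 'k::field_char_0"
  assumes y: "sum y UNIV = 0"
    and nonzero: "of_nat CARD('n) * d * m ^ 3 + b * m * (\<Sum>i\<in>UNIV. y i ^ 2) + a * (\<Sum>i\<in>UNIV. y i ^ 3) \<noteq> 0"
    and ker: "\<And>w \<mu>. sum w UNIV = 0 \<Longrightarrow>
      3 * of_nat CARD('n) * d * m * \<mu> + b * (\<Sum>i\<in>UNIV. y i * w i) = 0 \<Longrightarrow>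
      (\<And>i. of_nat CARD('n) * (b * (m * w i + \<mu> * y i) + 3 * a * (y i * w i)) =
        3 * a * (\<Sum>i\<in>UNIV. y i * w i)) \<Longrightarrow>
      d * \<mu> = 0 \<and> b * \<mu> = 0 \<and> (\<forall>i. b * w i = 0 \<and> a * w i = 0)"
  shows "strong_lefschetz (ann (centered_cubic d b a :: ('n, 'k) mpol))"
proof (rule cubic_hessian_criterion[OF centered_cubic_in_homogeneous_part])
  let ?F = "centered_cubic d b a :: ('n, 'k) mpol"
  show "meval (\<lambda>i. y i + m) ?F \<noteq> 0"
    using nonzero by (simp add: meval_centered_cubic[OF y])
  fix c :: "'n \<Rightarrow> 'k" and v :: "'k ^ 'n"
  assume v: "map_matrix (meval (\<lambda>i. y i + m)) (hessian ?F) *v v = 0"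
  obtain w \<mu> where w: "($) v = (\<lambda>i. w i + \<mu>)" "sum w UNIV = 0"
    by (rule mean_decomposition[of "($) v"])
  then have v_eq: "v = (\<chi> i. w i + \<mu>)" by (simp add: vec_eq_iff fun_eq_iff)
  have \<mu>_w: "d * \<mu> = 0" "b * \<mu> = 0" "b * w i = 0" "a * w i = 0" for i
    using ker[OF w(2)] v unfolding v_eq centered_cubic_hessian_kernel_iff[OF y w(2)] by blast+
  obtain z t where z: "c = (\<lambda>i. z i + t)" "sum z UNIV = 0"
    by (rule mean_decomposition[of c])
  let ?n = "of_nat CARD('n) :: 'k" and ?q = "\<Sum>i\<in>UNIV. z i * w i"
  have "k * ?q = (\<Sum>i\<in>UNIV. z i * (k * w i))" for k
    by (simp add: sum_distrib_left mult.left_commute)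
  then have q: "b * ?q = 0" "a * ?q = 0" by (simp_all add: \<mu>_w)
  have "3 * ?n * d * t * \<mu> + b * ?q = 3 * ?n * t * (d * \<mu>) + b * ?q"
    by (simp add: mult_ac)
  moreover have "?n * (b * (t * w i + \<mu> * z i) + 3 * a * (z i * w i)) =
      ?n * (t * (b * w i) + z i * (b * \<mu>) + 3 * z i * (a * w i))" for i
    by (simp add: algebra_simps)
  ultimately show "map_matrix (meval c) (hessian ?F) *v v = 0"
    unfolding v_eq z(1) centered_cubic_hessian_kernel_iff[OF z(2) w(2)]
    by (simp add: \<mu>_w q mult.assoc)
qed

text \<open>
  A point of mean zero with nonvanishing coordinates.  Its third moment and the sum of the inverses of
  its coordinates contain a factor \<open>n - 2\<close>; this is where \<open>n \<ge> 3\<close> is needed.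
\<close>

definition balanced :: "'n::finite \<Rightarrow> 'n \<Rightarrow> 'k::comm_ring_1" where
  "balanced k i = (if i = k then 1 - of_nat CARD('n) else 1)"

lemma sum_balanced:
  fixes f :: "'k::comm_ring_1 \<Rightarrow> 'k" and k :: "'n::finite"
  shows "(\<Sum>i\<in>UNIV. f (balanced k i)) = f (1 - of_nat CARD('n)) + (of_nat CARD('n) - 1) * f 1"
proof -
  have "(\<Sum>i\<in>UNIV. f (balanced k i)) = f (balanced k k) + (\<Sum>i\<in>UNIV - {k}. f (balanced k i))"
    by (rule sum.remove) auto
  also have "(\<Sum>i\<in>UNIV - {k}. f (balanced k i)) = (\<Sum>i\<in>UNIV - {k}. f 1)"
    by (intro sum.cong) (auto simp: balanced_def)
  also have "\<dots> = (of_nat CARD('n) - 1) * f 1"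
  proof -
    have "1 \<le> CARD('n)" by (simp add: Suc_le_eq One_nat_def)
    then show ?thesis by (simp add: card_Diff_singleton of_nat_diff)
  qed
  finally show ?thesis by (simp add: balanced_def)
qed

lemma balanced_moments:
  fixes k :: "'n::finite"
  shows "(\<Sum>i\<in>UNIV. balanced k i) = (0 :: 'k::comm_ring_1)"
    and "(\<Sum>i\<in>UNIV. balanced k i ^ 2) = (of_nat CARD('n) * (of_nat CARD('n) - 1) :: 'k)"
    and "(\<Sum>i\<in>UNIV. balanced k i ^ 3) =
      - (of_nat CARD('n) * (of_nat CARD('n) - 1) * (of_nat CARD('n) - 2) :: 'k)"
  using sum_balanced[of "\<lambda>x. x" k] sum_balanced[of "\<lambda>x. x ^ 2" k] sum_balanced[of "\<lambda>x. x ^ 3" k]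
  by (simp_all add: power2_eq_square power3_eq_cube algebra_simps)

context
  fixes k :: "'n::finite"
  assumes card: "CARD('n) \<ge> 3"
begin

lemma of_nat_card_neq:
  "of_nat CARD('n) \<noteq> (0 :: 'k::field_char_0)" "of_nat CARD('n) \<noteq> (1 :: 'k)" "of_nat CARD('n) \<noteq> (2 :: 'k)"
proof -
  have "CARD('n) \<noteq> 0" "CARD('n) \<noteq> 1" "CARD('n) \<noteq> 2" using card by auto
  then show "of_nat CARD('n) \<noteq> (0 :: 'k)" "of_nat CARD('n) \<noteq> (1 :: 'k)" "of_nat CARD('n) \<noteq> (2 :: 'k)"
    using of_nat_eq_iff[where ?'a = 'k, of "CARD('n)"] by (metis of_nat_0 of_nat_1 of_nat_numeral)+
qed

lemma balanced_nonzero: "balanced k i \<noteq> (0 :: 'k::field_char_0)"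
  using of_nat_card_neq(2) by (simp add: balanced_def)

lemma eq_0_if_balanced_mult_const:
  fixes w :: "'n \<Rightarrow> 'k::field_char_0"
  assumes sum_w: "sum w UNIV = 0" and const: "\<And>i. balanced k i * w i = t"
  shows "w i = 0"
proof -
  let ?n = "of_nat CARD('n) :: 'k"
  have w: "w i = t / balanced k i" for i
    using const[of i] balanced_nonzero[where 'k = 'k] by (simp add: field_simps)
  have "sum w UNIV = t / (1 - ?n) + (?n - 1) * t"
    using sum_balanced[of "\<lambda>x. t / x" k] by (simp add: w)
  then have "?n * (?n - 2) * t = 0"
    using sum_w of_nat_card_neq(2)[where 'k = 'k] by (simp add: field_simps)
  then show ?thesis using of_nat_card_neq[where 'k = 'k] by (simp add: w)
qed

lemma strong_lefschetz_centered_cubic_at_balanced_point: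
  fixes a b :: "'k::field_char_0"
  assumes a: "a \<noteq> 0" and b: "b \<noteq> 0"
  shows "strong_lefschetz (ann (centered_cubic d b a :: ('n, 'k) mpol))"
proof (rule strong_lefschetz_centered_cubicI[where m = 0 and y = "balanced k"])
  let ?n = "of_nat CARD('n) :: 'k"
  show "?n * d * 0 ^ 3 + b * 0 * (\<Sum>i\<in>UNIV. balanced k i ^ 2) + a * (\<Sum>i\<in>UNIV. balanced k i ^ 3) \<noteq> 0"
    unfolding balanced_moments using a of_nat_card_neq[where 'k = 'k] by simp
  fix w \<mu>
  assume sum_w: "sum w UNIV = 0"
    and mean: "3 * ?n * d * 0 * \<mu> + b * (\<Sum>i\<in>UNIV. balanced k i * w i) = 0"
    and dev: "\<And>i. ?n * (b * (0 * w i + \<mu> * balanced k i) + 3 * a * (balanced k i * w i)) =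
      3 * a * (\<Sum>i\<in>UNIV. balanced k i * w i)"
  have "?n * (balanced k i * (b * \<mu> + 3 * a * w i)) = 0" for i
    using dev[of i] mean b by (simp add: algebra_simps)
  then have w: "b * \<mu> + 3 * a * w i = 0" for i
    using balanced_nonzero of_nat_card_neq(1) by (metis mult_eq_0_iff)
  then have "(\<Sum>i\<in>UNIV. b * \<mu> + 3 * a * w i) = 0" by simp
  then have "?n * (b * \<mu>) = 0" by (simp add: sum.distrib sum_w flip: sum_distrib_left)
  then have "\<mu> = 0" using b by simp
  with w a show "d * \<mu> = 0 \<and> b * \<mu> = 0 \<and> (\<forall>i. b * w i = 0 \<and> a * w i = 0)" by simp
qed (rule balanced_moments)

lemma strong_lefschetz_centered_cubic_at_shifted_balanced_point:
  fixes a :: "'k::field_char_0"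
  assumes a: "a \<noteq> 0"
  shows "strong_lefschetz (ann (centered_cubic d 0 a :: ('n, 'k) mpol))"
proof -
  let ?n = "of_nat CARD('n) :: 'k" and ?p3 = "\<Sum>i\<in>UNIV. balanced k i ^ 3 :: 'k"
  have "a * ?p3 \<noteq> 0"
    unfolding balanced_moments using a of_nat_card_neq[where 'k = 'k] by simp
  moreover have "(?n * d * 1 ^ 3 + a * ?p3) + (?n * d * (- 1) ^ 3 + a * ?p3) = 2 * (a * ?p3)"
    by simp
  ultimately have "?n * d * 1 ^ 3 + a * ?p3 \<noteq> 0 \<or> ?n * d * (- 1) ^ 3 + a * ?p3 \<noteq> 0"
    by (metis add_0 mult_eq_0_iff zero_neq_numeral)
  then obtain m where m: "m \<noteq> 0" "?n * d * m ^ 3 + a * ?p3 \<noteq> 0"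
    by (metis neg_equal_0_iff_equal zero_neq_one)
  show ?thesis
  proof (rule strong_lefschetz_centered_cubicI[where m = m and y = "balanced k"])
    show "?n * d * m ^ 3 + 0 * m * (\<Sum>i\<in>UNIV. balanced k i ^ 2) + a * ?p3 \<noteq> 0"
      using m(2) by simp
    fix w \<mu>
    assume sum_w: "sum w UNIV = 0"
      and mean: "3 * ?n * d * m * \<mu> + 0 * (\<Sum>i\<in>UNIV. balanced k i * w i) = 0"
      and dev: "\<And>i. ?n * (0 * (m * w i + \<mu> * balanced k i) + 3 * a * (balanced k i * w i)) =
        3 * a * (\<Sum>i\<in>UNIV. balanced k i * w i)"
    have "balanced k i * w i = (\<Sum>i\<in>UNIV. balanced k i * w i) / ?n" for i
      using dev[of i] a by (simp add: field_simps)
    then have "w i = 0" for i by (rule eq_0_if_balanced_mult_const[OF sum_w])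
    moreover have "d * \<mu> = 0" using mean m(1) by auto
    ultimately show "d * \<mu> = 0 \<and> 0 * \<mu> = 0 \<and> (\<forall>i. 0 * w i = 0 \<and> a * w i = 0)" by simp
  qed (rule balanced_moments)
qed

lemma strong_lefschetz_centered_cubic_mean_times_variance:
  fixes b :: "'k::field_char_0"
  assumes b: "b \<noteq> 0"
  shows "strong_lefschetz (ann (centered_cubic 0 b 0 :: ('n, 'k) mpol))"
proof (rule strong_lefschetz_centered_cubicI[where m = 1 and y = "balanced k"])
  let ?n = "of_nat CARD('n) :: 'k" and ?q = "\<lambda>w. \<Sum>i\<in>UNIV. balanced k i * w i :: 'k"
  show "?n * 0 * 1 ^ 3 + b * 1 * (\<Sum>i\<in>UNIV. balanced k i ^ 2) + 0 * (\<Sum>i\<in>UNIV. balanced k i ^ 3) \<noteq> 0"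
    unfolding balanced_moments using b of_nat_card_neq[where 'k = 'k] by simp
  fix w \<mu>
  assume mean: "3 * ?n * 0 * 1 * \<mu> + b * ?q w = 0"
    and dev: "\<And>i. ?n * (b * (1 * w i + \<mu> * balanced k i) + 3 * 0 * (balanced k i * w i)) = 3 * 0 * ?q w"
  have w: "w i = - \<mu> * balanced k i" for i
    using dev[of i] b by (simp add: eq_neg_iff_add_eq_0)
  have "?q w = - \<mu> * (\<Sum>i\<in>UNIV. balanced k i ^ 2)"
    unfolding w sum_distrib_left by (simp add: power2_eq_square mult_ac)
  then have "\<mu> = 0"
    unfolding balanced_moments using mean b of_nat_card_neq[where 'k = 'k] by simp
  then show "0 * \<mu> = 0 \<and> b * \<mu> = 0 \<and> (\<forall>i. b * w i = 0 \<and> 0 * w i = 0)" by (simp add: w)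
qed (rule balanced_moments)

end

lemma strong_lefschetz_centered_cubic_at_constant_point:
  fixes d :: "'k::field_char_0"
  assumes d: "d \<noteq> 0"
  shows "strong_lefschetz (ann (centered_cubic d b 0 :: ('n::finite, 'k) mpol))"
proof (rule strong_lefschetz_centered_cubicI[where m = 1 and y = "\<lambda>_. 0"])
  let ?n = "of_nat CARD('n) :: 'k"
  fix w \<mu>
  assume "3 * ?n * d * 1 * \<mu> + b * (\<Sum>i\<in>UNIV. 0 * w i) = 0"
    and "\<And>i. ?n * (b * (1 * w i + \<mu> * 0) + 3 * 0 * (0 * w i)) = 3 * 0 * (\<Sum>i\<in>UNIV. 0 * w i)"
  with d show "d * \<mu> = 0 \<and> b * \<mu> = 0 \<and> (\<forall>i. b * w i = 0 \<and> 0 * w i = 0)" by simp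
qed (use d in simp_all)

lemma strong_lefschetz_centered_cubic:
  fixes d b a :: "'k::field_char_0"
  assumes "CARD('n::finite) \<ge> 3" and "(d, b, a) \<noteq> (0, 0, 0)"
  shows "strong_lefschetz (ann (centered_cubic d b a :: ('n, 'k) mpol))"
proof -
  consider (balanced) "a \<noteq> 0" "b \<noteq> 0" | (shifted_balanced) "a \<noteq> 0" "b = 0"
    | (constant_point) "a = 0" "d \<noteq> 0" | (mean_times_variance) "a = 0" "d = 0" "b \<noteq> 0"
    using assms(2) by auto
  then show ?thesis
  proof cases
    case balanced
    with assms(1) show ?thesis by (rule strong_lefschetz_centered_cubic_at_balanced_point)
  next
    case shifted_balanced
    then show ?thesis using strong_lefschetz_centered_cubic_at_shifted_balanced_point[OF assms(1)] by simp
  next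
    case constant_point
    then show ?thesis using strong_lefschetz_centered_cubic_at_constant_point by simp
  next
    case mean_times_variance
    then show ?thesis using strong_lefschetz_centered_cubic_mean_times_variance[OF assms(1)] by simp
  qed
qed

theorem proposition4p10:
  fixes a0 a1 a2 :: "'k::field_char_0"
    and F :: "('n::finite, 'k) mpol"
  assumes "CARD('n) \<ge> 3"
    and "F = mconst a0 * power_sum 1 ^ 3
           + mconst a1 * of_nat CARD('n) * power_sum 1 * power_sum 2
           + mconst a2 * of_nat CARD('n) ^ 2 * power_sum 3"
    and "F \<noteq> 0"
  shows "strong_lefschetz (ann F)"
proof -
  have F: "F = centered_cubic (a0 + a1 + a2) (a1 + 3 * a2) a2"
    unfolding centered_cubic_def assms(2) by (simp add: algebra_simps)
  moreover have "(a0 + a1 + a2, a1 + 3 * a2, a2) \<noteq> (0, 0, 0)"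
    using assms(3) unfolding F by (auto simp: centered_cubic_def)
  ultimately show ?thesis
    using strong_lefschetz_centered_cubic[OF assms(1)] by simp
qed

end
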